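(* Let $n\ge 9$ be an integer such that $p=(2n-1)(2n+1)$ and $q=(4n-3)(4n+1)$ are coprime, squarefree integers. Let $K=\mathbb{Q}(\sqrt p,\sqrt q)$ and $r=pq$. Let $\varepsilon_p,\varepsilon_q,\varepsilon_r>1$ be the fundamental units of $\mathbb{Q}(\sqrt p),\mathbb{Q}(\sqrt q),\mathbb{Q}(\sqrt r)$ respectively. A complete set of indecomposable elements of $\mathcal{O}_K^+$ modulo totally positive units is given by \begin{align*} &1,\qquad \frac{\varepsilon_p^{-1}+\varepsilon_r}{2}+t\left(\varepsilon_q-\varepsilon_p^{-1}\right)\qquad(0\le t\le 2n-2),\\ &\left(\varepsilon_p^{-1}-\varepsilon_q\right)+t\left(\varepsilon_p\varepsilon_q-1\right)\qquad(1\le t\le 2n-1), \end{align*} where $t$ runs over integers in the indicated ranges. In particular, $\iota(K)=4n-1$.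
   Context: For a totally real number field $F$ with ring of integers $\mathcal{O}_F$, $\mathcal{O}_F^+$ denotes the set of elements of $\mathcal{O}_F$ that are positive under every embedding $F\hookrightarrow\mathbb{R}$ (totally positive). An element $\alpha\in\mathcal{O}_F^+$ is indecomposable if it cannot be written as $\alpha=\beta+\gamma$ with $\beta,\gamma\in\mathcal{O}_F^+$. $\iota(F)$ denotes the (finite) number of indecomposable elements of $\mathcal{O}_F^+$ up to multiplication by totally positive units of $\mathcal{O}_F$. A complete set of indecomposable elements modulo totally positive units is a set of representatives, one for each class, of the indecomposable elements of $\mathcal{O}_F^+$ under the equivalence $\alpha\sim\eta\alpha$ with $\eta$ a totally positive unit of $\mathcal{O}_F$. All square roots are taken positive; explicitly, $\varepsilon_p=2n+\sqrt p$, $\varepsilon_q=\frac{4n-1+\sqrt q}{2}$, $\varepsilon_r=(8n^2-2n-2)+\sqrt r$. *)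

theory Defs
  imports Complex_Main "HOL-Computational_Algebra.Computational_Algebra"
begin

(* Fields are realised as subfields of the reals. A totally real number field has a real
   embedding, hence is isomorphic to such a subfield, and all notions below are invariant under
   field isomorphism (except the choice of the fundamental unit, which refers to the given
   embedding through the order of the reals). *)

definition real_subfield :: "real set \<Rightarrow> bool" where
  "real_subfield F \<longleftrightarrow>
     0 \<in> F \<and> 1 \<in> F \<and>
     (\<forall>x\<in>F. \<forall>y\<in>F. x + y \<in> F \<and> x * y \<in> F) \<and>
     (\<forall>x\<in>F. - x \<in> F \<and> inverse x \<in> F)"

definition rat_adjoin :: "real set \<Rightarrow> real set" where
  "rat_adjoin A = real_subfield hull A"

definition ring_of_integers :: "real set \<Rightarrow> real set" where
  "ring_of_integers F = {x \<in> F. algebraic_int x}"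

definition integer_units :: "real set \<Rightarrow> real set" where
  "integer_units F = {u \<in> ring_of_integers F. \<exists>v \<in> ring_of_integers F. u * v = 1}"

(* Only the values of an embedding on F matter; outside F it is arbitrary. *)
definition real_embedding :: "real set \<Rightarrow> (real \<Rightarrow> real) \<Rightarrow> bool" where
  "real_embedding F \<sigma> \<longleftrightarrow>
     \<sigma> 1 = 1 \<and>
     (\<forall>x\<in>F. \<forall>y\<in>F. \<sigma> (x + y) = \<sigma> x + \<sigma> y \<and> \<sigma> (x * y) = \<sigma> x * \<sigma> y)"

definition totally_positive_integers :: "real set \<Rightarrow> real set" where
  "totally_positive_integers F =
     {x \<in> ring_of_integers F. \<forall>\<sigma>. real_embedding F \<sigma> \<longrightarrow> \<sigma> x > 0}"

definition totally_positive_units :: "real set \<Rightarrow> real set" where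
  "totally_positive_units F = integer_units F \<inter> totally_positive_integers F"

definition indecomposables :: "real set \<Rightarrow> real set" where
  "indecomposables F =
     {\<alpha> \<in> totally_positive_integers F.
        \<not> (\<exists>\<beta> \<in> totally_positive_integers F. \<exists>\<gamma> \<in> totally_positive_integers F. \<alpha> = \<beta> + \<gamma>)}"

definition indecomposable_rel :: "real set \<Rightarrow> (real \<times> real) set" where
  "indecomposable_rel F =
     {(\<alpha>, \<beta>). \<alpha> \<in> indecomposables F \<and> \<beta> \<in> indecomposables F \<and>
               (\<exists>\<eta> \<in> totally_positive_units F. \<beta> = \<eta> * \<alpha>)}"

definition indecomposable_classes :: "real set \<Rightarrow> real set set" where
  "indecomposable_classes F = indecomposables F // indecomposable_rel F"

definition iota :: "real set \<Rightarrow> nat" where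
  "iota F = card (indecomposable_classes F)"

definition complete_set_of_indecomposables :: "real set \<Rightarrow> real set \<Rightarrow> bool" where
  "complete_set_of_indecomposables F S \<longleftrightarrow>
     S \<subseteq> indecomposables F \<and> (\<forall>C \<in> indecomposable_classes F. \<exists>!s. s \<in> S \<inter> C)"

definition fundamental_unit :: "real set \<Rightarrow> real \<Rightarrow> bool" where
  "fundamental_unit F \<epsilon> \<longleftrightarrow>
     \<epsilon> \<in> integer_units F \<and> \<epsilon> > 1 \<and>
     (\<forall>u \<in> integer_units F. \<exists>k::int. u = \<epsilon> powi k \<or> u = - (\<epsilon> powi k))"

end

theory Submission
  imports Defs "Jordan_Normal_Form.Char_Poly"
begin

text \<open>
  Write \<open>P\<close>, \<open>Q\<close> for the fundamental units \<open>\<epsilon>\<^sub>p\<close>, \<open>\<epsilon>\<^sub>q\<close>, so \<open>P + 1/P = 4n\<close> and \<open>Q + 1/Q = 4n - 1\<close>; then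
  \<open>1, P, Q, PQ\<close> is an integral basis of \<open>K\<close>. The element \<open>U = PQ - 1\<close> is a unit with \<open>1/U = 1/Q - 1/P\<close> and
  \<open>U\<^sup>2 = PQ\<epsilon>\<^sub>r\<close>. Up to the factor \<open>1/P\<close>, the nontrivial elements of the list are exactly
  \<open>U (k - 1/P)\<close> for \<open>1 \<le> k \<le> 4n - 2\<close>.

  Two integral linear forms are positive on all totally positive integers \<open>a + bP + cQ + dPQ\<close>:
  \<open>L = a + (4n - 2)b + c + d\<close> and \<open>M = a + b + c + d\<close>. Since \<open>L\<close> takes the value 1 at every listed
  element, these are indecomposable. Conversely, given a totally positive integer \<open>\<alpha>\<close>, replace it by
  the associate for which the smaller of \<open>L\<close> and \<open>M\<close> is least. Comparing with a dozen explicit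
  associates shows that \<open>\<alpha>\<close> lies in the cone over the facet \<open>M = 1\<close> or \<open>L = 1\<close> of the convex hull of the
  totally positive integers. The first cone is spanned by \<open>1, P, Q, PQ\<close>. The second one is the cone over a
  Cayley polytope of two lattice hexagons, and its lattice points are sums of lattice points at
  height one, that is, of units and of associates of listed elements.
\<close>

section \<open>Algebraic integers and real subfields\<close>

text \<open>Both forms are traces against totally positive elements of the codifferent.
  \<open>M\<close> is chosen to be 1 at 1, P, Q, PQ. \<open>L\<close> is chosen to vanish on U and
  QU, so that the progression U (k - 1/P), whose step is U, stays on one level set. Minimising works
  because the ray through \<alpha> leaves the convex hull through the facet whose form, normalised
  to 1 there, is smallest at \<alpha>. Once a form is minimal, comparing it with finitely many
  adjacent ones already gives all inequalities of the cone over its facet: four for the simplex,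
  twelve for the other facet. So no list of all facets and no fundamental domain is needed, and
  integrality of the forms makes the descent stop. The obstacle is the second facet, which is far
  from a unimodular simplex. A point at height A + B is split into a point of A times one hexagon
  and a point of B times the other, and each dilated hexagon is then resolved into its own lattice
  points. The second hexagon is Q times the first. The middle row of the first has 4n - 1 points,
  whose two ends are associates; the other lattice points are units. This leaves 4n - 2 candidates
  besides the class of 1.\<close>

lemma algebraic_int_eigenvalue:
  fixes z :: real and v :: "nat \<Rightarrow> real" and A :: "nat \<Rightarrow> nat \<Rightarrow> int"
  assumes eq: "\<And>i. i < D \<Longrightarrow> z * v i = (\<Sum>j<D. of_int (A i j) * v j)"
    and nz: "k < D" "v k \<noteq> 0"
  shows "algebraic_int z"
proof -
  define M where "M = mat D D (\<lambda>(i, j). A i j)"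
  define MR :: "real mat" where "MR = map_mat of_int M"
  have M: "M \<in> carrier_mat D D" and MR: "MR \<in> carrier_mat D D"
    by (auto simp: M_def MR_def)
  have "eigenvector MR (vec D v) z"
    unfolding eigenvector_def
  proof (intro conjI)
    show "vec D v \<in> carrier_vec (dim_row MR)" using MR by auto
    show "vec D v \<noteq> 0\<^sub>v (dim_row MR)" using nz MR
      by (auto simp: vec_eq_iff)
    show "MR *\<^sub>v vec D v = z \<cdot>\<^sub>v vec D v"
      by (rule eq_vecI)
        (auto simp: MR_def M_def scalar_prod_def eq atLeast0LessThan)
  qed
  then have "eigenvalue MR z" unfolding eigenvalue_def by blast
  then have "poly (char_poly MR) z = 0" using eigenvalue_root_char_poly[OF MR] by simp
  moreover have "char_poly MR = map_poly of_int (char_poly M)"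
    unfolding MR_def using of_int_hom.char_poly_hom[OF M] by simp
  moreover have "lead_coeff (char_poly M) = 1"
    using degree_monic_char_poly[OF M] by simp
  ultimately show ?thesis
    unfolding algebraic_int_altdef_ipoly by auto
qed

definition int_span :: "real set \<Rightarrow> real set" where
  "int_span G = {\<Sum>g\<in>G. of_int (c g) * g | c :: real \<Rightarrow> int. True}"

lemma int_span_base: "finite G \<Longrightarrow> g \<in> G \<Longrightarrow> g \<in> int_span G"
  unfolding int_span_def
  by (rule CollectI, rule exI[of _ "\<lambda>x. if x = g then 1 else 0"])
    (simp add: sum.delta if_distrib[of "\<lambda>x. x * _"] if_distrib[of of_int] cong: if_cong)

lemma int_span_0: "0 \<in> int_span G"
  unfolding int_span_def by (rule CollectI, rule exI[of _ "\<lambda>_. 0"]) simp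

lemma int_span_add: "x \<in> int_span G \<Longrightarrow> y \<in> int_span G \<Longrightarrow> x + y \<in> int_span G"
  unfolding int_span_def
proof clarify
  fix c d :: "real \<Rightarrow> int"
  show "\<exists>e. (\<Sum>g\<in>G. of_int (c g) * g) + (\<Sum>g\<in>G. of_int (d g) * g) = (\<Sum>g\<in>G. of_int (e g) * g) \<and> True"
    by (rule exI[of _ "\<lambda>g. c g + d g"]) (simp add: sum.distrib algebra_simps)
qed

lemma int_span_scale: "x \<in> int_span G \<Longrightarrow> of_int k * x \<in> int_span G"
  unfolding int_span_def
proof clarify
  fix c :: "real \<Rightarrow> int"
  show "\<exists>e. of_int k * (\<Sum>g\<in>G. of_int (c g) * g) = (\<Sum>g\<in>G. of_int (e g) * g) \<and> True"
    by (rule exI[of _ "\<lambda>g. k * c g"]) (simp add: sum_distrib_left algebra_simps)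
qed

lemma int_span_sum: "(\<And>i. i \<in> I \<Longrightarrow> f i \<in> int_span G) \<Longrightarrow> sum f I \<in> int_span G"
  by (induction I rule: infinite_finite_induct) (auto simp: int_span_0 int_span_add)

lemma int_span_mult:
  assumes "\<And>g. g \<in> G \<Longrightarrow> w * g \<in> int_span G" "x \<in> int_span G"
  shows "w * x \<in> int_span G"
proof -
  obtain c :: "real \<Rightarrow> int" where c: "x = (\<Sum>g\<in>G. of_int (c g) * g)"
    using assms(2) unfolding int_span_def by blast
  have "w * x = (\<Sum>g\<in>G. of_int (c g) * (w * g))"
    unfolding c by (simp add: sum_distrib_left algebra_simps)
  also have "\<dots> \<in> int_span G"
    by (intro int_span_sum int_span_scale assms(1))
  finally show ?thesis .
qed

text \<open>Multiplication by \<open>z\<close> acts on \<open>G\<close> through an integer matrix,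
  for which the vector of the elements of \<open>G\<close> is an eigenvector. The element 1 makes
  this vector nonzero.\<close>

lemma algebraic_int_int_span:
  assumes "finite G" "1 \<in> G" "\<And>g. g \<in> G \<Longrightarrow> z * g \<in> int_span G"
  shows "algebraic_int z"
proof -
  obtain v where v: "bij_betw v {..<card G} G"
    using ex_bij_betw_nat_finite[OF assms(1)] unfolding atLeast0LessThan by blast
  have "\<exists>c :: real \<Rightarrow> int. z * g = (\<Sum>h\<in>G. of_int (c h) * h)" if "g \<in> G" for g
    using assms(3)[OF that] unfolding int_span_def by blast
  then obtain c :: "real \<Rightarrow> real \<Rightarrow> int"
    where c: "\<And>g. g \<in> G \<Longrightarrow> z * g = (\<Sum>h\<in>G. of_int (c g h) * h)" by metis
  have vG: "v i \<in> G" if "i < card G" for i using v that by (auto simp: bij_betw_def)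
  obtain k where k: "k < card G" "v k = 1"
    using v assms(2) unfolding bij_betw_def by (metis imageE lessThan_iff)
  show ?thesis
  proof (rule algebraic_int_eigenvalue[of "card G" z v "\<lambda>i j. c (v i) (v j)" k])
    fix i assume i: "i < card G"
    show "z * v i = (\<Sum>j<card G. of_int (c (v i) (v j)) * v j)"
      using c[OF vG[OF i]] sum.reindex_bij_betw[OF v, of "\<lambda>h. of_int (c (v i) h) * h"] by simp
  qed (use k in auto)
qed

lemma algebraic_int_power_reduce:
  fixes x :: real
  assumes "algebraic_int x"
  obtains d and a :: "nat \<Rightarrow> int" where "d > 0" "x ^ d = (\<Sum>i<d. of_int (a i) * x ^ i)"
proof -
  obtain p :: "int poly" where p: "poly (map_poly of_int p) x = 0" "lead_coeff p = 1"
    using assms unfolding algebraic_int_altdef_ipoly by blast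
  have "degree p > 0"
  proof (rule ccontr)
    assume "\<not> degree p > 0"
    then obtain c where "p = [:c:]" using degree_eq_zeroE by blast
    then show False using p by simp
  qed
  have "0 = (\<Sum>i\<le>degree p. of_int (coeff p i) * x ^ i)"
    using p(1) by (simp add: poly_altdef degree_map_poly coeff_map_poly)
  also have "\<dots> = (\<Sum>i<degree p. of_int (coeff p i) * x ^ i) + x ^ degree p"
    using p(2) by (simp add: lessThan_Suc_atMost[symmetric])
  finally have "x ^ degree p = (\<Sum>i<degree p. of_int (- coeff p i) * x ^ i)"
    by (simp add: sum_negf)
  then show ?thesis using that[of "degree p" "\<lambda>i. - coeff p i"] \<open>degree p > 0\<close> by blast
qed

text \<open>The monomials x^i y^j with i < d and j < e span a module that is stable under
  multiplication by \<open>x\<close> and by \<open>y\<close>, hence also by their sum and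
  product.\<close>

lemma algebraic_int_add_mult:
  fixes x y :: real
  assumes "algebraic_int x" "algebraic_int y"
  shows "algebraic_int (x + y)" "algebraic_int (x * y)"
proof -
  obtain d and a :: "nat \<Rightarrow> int" where d: "d > 0" "x ^ d = (\<Sum>i<d. of_int (a i) * x ^ i)"
    using algebraic_int_power_reduce[OF assms(1)] .
  obtain e and b :: "nat \<Rightarrow> int" where e: "e > 0" "y ^ e = (\<Sum>i<e. of_int (b i) * y ^ i)"
    using algebraic_int_power_reduce[OF assms(2)] .
  define G where "G = (\<lambda>(i, j). x ^ i * y ^ j) ` ({..<d} \<times> {..<e})"
  have fin: "finite G" by (auto simp: G_def)
  have G: "x ^ i * y ^ j \<in> int_span G" if "i < d" "j < e" for i j
    by (rule int_span_base[OF fin]) (use that in \<open>auto simp: G_def\<close>)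
  have "1 \<in> G" unfolding G_def using d(1) e(1) by (auto intro!: image_eqI[of _ _ "(0, 0)"])
  have X: "x * g \<in> int_span G" if g: "g \<in> G" for g
  proof -
    obtain i j where ij: "i < d" "j < e" "g = x ^ i * y ^ j" using g by (auto simp: G_def)
    show ?thesis
    proof (cases "Suc i < d")
      case True
      then show ?thesis using G[of "Suc i" j] ij by (simp add: mult.assoc)
    next
      case False
      then have "d = Suc i" using ij by simp
      then have "x * g = x ^ d * y ^ j" using ij by simp
      also have "\<dots> = (\<Sum>i<d. of_int (a i) * (x ^ i * y ^ j))"
        unfolding d(2) by (simp add: sum_distrib_right mult.assoc)
      also have "\<dots> \<in> int_span G" using ij by (intro int_span_sum int_span_scale G) auto
      finally show ?thesis .
    qed
  qed
  have Y: "y * g \<in> int_span G" if g: "g \<in> G" for g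
  proof -
    obtain i j where ij: "i < d" "j < e" "g = x ^ i * y ^ j" using g by (auto simp: G_def)
    show ?thesis
    proof (cases "Suc j < e")
      case True
      then show ?thesis using G[of i "Suc j"] ij by (simp add: algebra_simps)
    next
      case False
      then have "e = Suc j" using ij by simp
      then have "y * g = x ^ i * y ^ e" using ij by simp
      also have "\<dots> = (\<Sum>j<e. of_int (b j) * (x ^ i * y ^ j))"
        unfolding e(2) by (simp add: sum_distrib_left algebra_simps)
      also have "\<dots> \<in> int_span G" using ij by (intro int_span_sum int_span_scale G) auto
      finally show ?thesis .
    qed
  qed
  show "algebraic_int (x + y)"
    by (rule algebraic_int_int_span[OF fin \<open>1 \<in> G\<close>]) (auto simp: distrib_right X Y intro!: int_span_add)
  show "algebraic_int (x * y)"
    by (rule algebraic_int_int_span[OF fin \<open>1 \<in> G\<close>])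
      (metis mult.assoc int_span_mult[of G x, OF X] Y)
qed

section \<open>Subfields of the reals, quadratic extensions and embeddings\<close>

lemma real_subfieldD:
  assumes "real_subfield F"
  shows "0 \<in> F" "1 \<in> F" "x \<in> F \<Longrightarrow> y \<in> F \<Longrightarrow> x + y \<in> F" "x \<in> F \<Longrightarrow> y \<in> F \<Longrightarrow> x * y \<in> F"
    "x \<in> F \<Longrightarrow> - x \<in> F" "x \<in> F \<Longrightarrow> inverse x \<in> F"
    "x \<in> F \<Longrightarrow> y \<in> F \<Longrightarrow> x - y \<in> F" "x \<in> F \<Longrightarrow> y \<in> F \<Longrightarrow> x / y \<in> F"
proof -
  show add: "x \<in> F \<Longrightarrow> y \<in> F \<Longrightarrow> x + y \<in> F" and mult: "x \<in> F \<Longrightarrow> y \<in> F \<Longrightarrow> x * y \<in> F"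
    and neg: "x \<in> F \<Longrightarrow> - x \<in> F" and inv: "x \<in> F \<Longrightarrow> inverse x \<in> F"
    and "0 \<in> F" and "1 \<in> F" for x y
    using assms unfolding real_subfield_def by blast+
  show "x \<in> F \<Longrightarrow> y \<in> F \<Longrightarrow> x - y \<in> F" using add[of x "- y"] neg[of y] by simp
  show "x \<in> F \<Longrightarrow> y \<in> F \<Longrightarrow> x / y \<in> F" using mult[of x "inverse y"] inv[of y] by (simp add: divide_inverse)
qed

lemma real_subfield_of_int: "real_subfield F \<Longrightarrow> of_int k \<in> F"
proof -
  assume F: "real_subfield F"
  have "of_nat m \<in> F" for m
    by (induction m) (simp_all add: real_subfieldD(1-3)[OF F])
  then show ?thesis
    by (cases k rule: int_cases2) (simp_all add: real_subfieldD(5)[OF F])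
qed

lemma real_subfield_Rats_subset:
  assumes F: "real_subfield F"
  shows "\<rat> \<subseteq> F"
proof
  fix x :: real assume "x \<in> \<rat>"
  then obtain a b :: int where "x = of_int a / of_int b" by (rule Rats_cases')
  then show "x \<in> F" using real_subfieldD(8)[OF F] real_subfield_of_int[OF F] by simp
qed

lemma real_subfield_Rats: "real_subfield \<rat>"
  by (auto simp: real_subfield_def)

lemma real_subfield_rat_adjoin: "real_subfield (rat_adjoin A)"
  unfolding rat_adjoin_def by (rule hull_in) (auto simp: real_subfield_def)

lemma rat_adjoin_empty: "rat_adjoin {} = \<rat>"
  unfolding rat_adjoin_def
  by (rule hull_unique) (auto simp: real_subfield_Rats dest: real_subfield_Rats_subset)

definition adjoin_sqrt :: "real set \<Rightarrow> real \<Rightarrow> real set" where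
  "adjoin_sqrt F s = {a + b * s | a b. a \<in> F \<and> b \<in> F}"

lemma adjoin_sqrtI: "a \<in> F \<Longrightarrow> b \<in> F \<Longrightarrow> a + b * s \<in> adjoin_sqrt F s"
  unfolding adjoin_sqrt_def by blast

lemma adjoin_sqrt_cong: "x = a + b * s \<Longrightarrow> a \<in> F \<Longrightarrow> b \<in> F \<Longrightarrow> x \<in> adjoin_sqrt F s"
  unfolding adjoin_sqrt_def by blast

lemma adjoin_sqrtE:
  assumes "x \<in> adjoin_sqrt F s"
  obtains a b where "a \<in> F" "b \<in> F" "x = a + b * s"
  using assms unfolding adjoin_sqrt_def by blast

lemma real_subfield_adjoin_sqrt:
  assumes F: "real_subfield F" and s: "s * s \<in> F"
  shows "real_subfield (adjoin_sqrt F s)"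
proof -
  note D = real_subfieldD[OF F]
  have sub: "x \<in> adjoin_sqrt F s" if "x \<in> F" for x
    using adjoin_sqrtI[OF that D(1), of s] by simp
  show ?thesis
    unfolding real_subfield_def
  proof (intro conjI ballI)
    show "0 \<in> adjoin_sqrt F s" "1 \<in> adjoin_sqrt F s" by (auto intro: sub D)
    fix x assume "x \<in> adjoin_sqrt F s"
    then obtain a b where x: "a \<in> F" "b \<in> F" "x = a + b * s" by (rule adjoin_sqrtE)
    show "- x \<in> adjoin_sqrt F s"
      using x by (intro adjoin_sqrt_cong[of _ "- a" "- b"] D) auto
    show "inverse x \<in> adjoin_sqrt F s"
    \<comment> \<open>If \<open>s\<close> lies in \<open>F\<close>, the conjugate a - b s can vanish
      although x is nonzero, so it cannot always serve to rationalise. In that case x = 2a is an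
      element of \<open>F\<close>.\<close>
    proof (cases "a = b * s")
      case True
      then have "inverse x = inverse (2 * a)" using x by simp
      also have "\<dots> \<in> adjoin_sqrt F s"
        using x D(3)[of a a] by (intro sub D(6)) (simp only: mult_2)
      finally show ?thesis .
    next
      case False
      define m where "m = a * a - b * b * (s * s)"
      have m: "m \<in> F" unfolding m_def by (intro D x s)
      show ?thesis
      proof (cases "x = 0")
        case True
        then show ?thesis by (auto intro: sub D)
      next
        case nz: False
        have "m = (a - b * s) * x" unfolding m_def x(3) by (simp add: algebra_simps)
        then have "inverse x = (a - b * s) / m"
          using nz False by (simp add: inverse_eq_divide)
        then have "inverse x = a / m + (- b / m) * s"
          by (simp add: diff_divide_distrib)
        then show ?thesis by (rule adjoin_sqrt_cong) (intro D x m)+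
      qed
    qed
    fix y assume "y \<in> adjoin_sqrt F s"
    then obtain c d where y: "c \<in> F" "d \<in> F" "y = c + d * s" by (rule adjoin_sqrtE)
    show "x + y \<in> adjoin_sqrt F s"
      using x y by (intro adjoin_sqrt_cong[of _ "a + c" "b + d"] D) (auto simp: algebra_simps)
    show "x * y \<in> adjoin_sqrt F s"
    proof (rule adjoin_sqrt_cong[of _ "a * c + b * d * (s * s)" "a * d + b * c"])
      show "x * y = (a * c + b * d * (s * s)) + (a * d + b * c) * s"
        unfolding x(3) y(3) by (simp add: algebra_simps)
    qed (intro D x y s)+
  qed
qed

lemma rat_adjoin_insert:
  assumes s: "s * s \<in> rat_adjoin A"
  shows "rat_adjoin (insert s A) = adjoin_sqrt (rat_adjoin A) s"
proof -
  have F: "real_subfield (rat_adjoin A)" by (rule real_subfield_rat_adjoin)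
  have A: "A \<subseteq> rat_adjoin A" unfolding rat_adjoin_def by (rule hull_subset)
  have "real_subfield hull (insert s A) = adjoin_sqrt (rat_adjoin A) s"
  proof (rule hull_unique)
    have "x \<in> adjoin_sqrt (rat_adjoin A) s" if "x \<in> A" for x
      using that A real_subfieldD(1)[OF F] by (intro adjoin_sqrt_cong[of _ x 0]) auto
    moreover have "s \<in> adjoin_sqrt (rat_adjoin A) s"
      using real_subfieldD(1,2)[OF F] by (intro adjoin_sqrt_cong[of _ 0 1]) auto
    ultimately show "insert s A \<subseteq> adjoin_sqrt (rat_adjoin A) s" by blast
    show "real_subfield (adjoin_sqrt (rat_adjoin A) s)"
      by (rule real_subfield_adjoin_sqrt[OF F s])
    fix T assume T: "insert s A \<subseteq> T" "real_subfield T"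
    then have "rat_adjoin A \<subseteq> T" unfolding rat_adjoin_def by (intro hull_minimal) auto
    then show "adjoin_sqrt (rat_adjoin A) s \<subseteq> T"
      using T(1) real_subfieldD(3,4)[OF T(2)] unfolding adjoin_sqrt_def by blast
  qed
  then show ?thesis unfolding rat_adjoin_def .
qed

lemma real_embeddingD:
  assumes "real_embedding F \<sigma>" "real_subfield F"
  shows "\<sigma> 1 = 1" "x \<in> F \<Longrightarrow> y \<in> F \<Longrightarrow> \<sigma> (x + y) = \<sigma> x + \<sigma> y"
    "x \<in> F \<Longrightarrow> y \<in> F \<Longrightarrow> \<sigma> (x * y) = \<sigma> x * \<sigma> y" "\<sigma> 0 = 0"
    "x \<in> F \<Longrightarrow> \<sigma> (- x) = - \<sigma> x" "x \<in> F \<Longrightarrow> y \<in> F \<Longrightarrow> \<sigma> (x - y) = \<sigma> x - \<sigma> y"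
proof -
  note D = real_subfieldD[OF assms(2)]
  show add: "\<sigma> (x + y) = \<sigma> x + \<sigma> y" if "x \<in> F" "y \<in> F" for x y
    using assms(1) that unfolding real_embedding_def by blast
  show "\<sigma> 1 = 1" using assms(1) unfolding real_embedding_def by blast
  show "\<sigma> (x * y) = \<sigma> x * \<sigma> y" if "x \<in> F" "y \<in> F"
    using assms(1) that unfolding real_embedding_def by blast
  show z: "\<sigma> 0 = 0" using add[of 0 0] D(1) by simp
  show neg: "\<sigma> (- x) = - \<sigma> x" if "x \<in> F" for x
    using add[of x "- x"] that z D(5) by simp
  show "\<sigma> (x - y) = \<sigma> x - \<sigma> y" if "x \<in> F" "y \<in> F"
    using add[of x "- y"] neg[of y] that D(5) by simp
qed

lemma real_embedding_of_int:
  assumes "real_embedding F \<sigma>" "real_subfield F"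
  shows "\<sigma> (of_int k) = of_int k"
proof -
  have nat: "\<sigma> (of_nat m) = of_nat m" for m
  proof (induction m)
    case (Suc m)
    have "of_nat m \<in> F" using real_subfield_of_int[OF assms(2), of "int m"] by simp
    then show ?case
      using Suc real_embeddingD(1,2)[OF assms] real_subfieldD(2)[OF assms(2)] by simp
  qed (simp add: real_embeddingD(4)[OF assms])
  show ?thesis
  proof (cases k rule: int_cases2)
    case (nonpos m)
    have "of_nat m \<in> F" using real_subfield_of_int[OF assms(2), of "int m"] by simp
    then show ?thesis using nonpos nat real_embeddingD(5)[OF assms] by simp
  qed (use nat in simp)
qed

lemma adjoin_sqrt_unique:
  assumes F: "real_subfield F" and s: "s \<notin> F"
    and ab: "a \<in> F" "b \<in> F" "a' \<in> F" "b' \<in> F" and eq: "a + b * s = a' + b' * s"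
  shows "a = a' \<and> b = b'"
proof (cases "b = b'")
  case False
  then have "s = (a' - a) / (b - b')" using eq by (simp add: field_simps)
  then show ?thesis using s ab by (metis real_subfieldD(7,8)[OF F])
qed (use eq in auto)

text \<open>Coordinates over \<open>F\<close> are unique because \<open>s\<close> is not in
  \<open>F\<close>, so each square root \<open>t\<close> of the image of s^2 gives a well-defined
  extension of \<tau>. Two such steps, with two signs each, produce the four embeddings of the
  biquadratic field.\<close>

lemma real_embedding_adjoin_sqrt:
  assumes F: "real_subfield F" and s: "s \<notin> F" "s * s \<in> F"
    and \<tau>: "real_embedding F \<tau>" and t: "t * t = \<tau> (s * s)"
  obtains \<sigma> where "real_embedding (adjoin_sqrt F s) \<sigma>"
    "\<And>a b. a \<in> F \<Longrightarrow> b \<in> F \<Longrightarrow> \<sigma> (a + b * s) = \<tau> a + \<tau> b * t"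
proof -
  note D = real_subfieldD[OF F] and E = real_embeddingD[OF \<tau> F]
  define \<sigma> where "\<sigma> x = (let (a, b) = SOME (a, b). a \<in> F \<and> b \<in> F \<and> x = a + b * s in \<tau> a + \<tau> b * t)" for x
  have \<sigma>: "\<sigma> (a + b * s) = \<tau> a + \<tau> b * t" if "a \<in> F" "b \<in> F" for a b
  proof -
    have "(SOME (a', b'). a' \<in> F \<and> b' \<in> F \<and> a + b * s = a' + b' * s) = (a, b)"
      by (rule some_equality) (use that adjoin_sqrt_unique[OF F s(1)] in auto)
    then show ?thesis unfolding \<sigma>_def by simp
  qed
  have "real_embedding (adjoin_sqrt F s) \<sigma>"
    unfolding real_embedding_def
  proof (intro conjI ballI)
    show "\<sigma> 1 = 1" using \<sigma>[of 1 0] D E by simp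
    fix x y assume "x \<in> adjoin_sqrt F s" "y \<in> adjoin_sqrt F s"
    then obtain a b c d where x: "a \<in> F" "b \<in> F" "x = a + b * s" and y: "c \<in> F" "d \<in> F" "y = c + d * s"
      by (metis adjoin_sqrtE)
    have "\<sigma> (x + y) = \<sigma> ((a + c) + (b + d) * s)" using x y by (simp add: algebra_simps)
    also have "\<dots> = \<tau> (a + c) + \<tau> (b + d) * t" by (rule \<sigma>) (intro D x y)+
    also have "\<dots> = (\<tau> a + \<tau> b * t) + (\<tau> c + \<tau> d * t)"
      by (simp add: E(2)[OF x(1) y(1)] E(2)[OF x(2) y(2)] algebra_simps)
    also have "\<dots> = \<sigma> x + \<sigma> y" using x y by (simp add: \<sigma>)
    finally show "\<sigma> (x + y) = \<sigma> x + \<sigma> y" .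
    have "\<sigma> (x * y) = \<sigma> ((a * c + b * d * (s * s)) + (a * d + b * c) * s)"
      using x y by (simp add: algebra_simps)
    also have "\<dots> = (\<tau> a * \<tau> c + \<tau> b * \<tau> d * \<tau> (s * s)) + (\<tau> a * \<tau> d + \<tau> b * \<tau> c) * t"
    proof (subst \<sigma>)
      show "a * c + b * d * (s * s) \<in> F" "a * d + b * c \<in> F" by (intro D x y s)+
      have "\<tau> (a * c + b * d * (s * s)) = \<tau> a * \<tau> c + \<tau> b * \<tau> d * \<tau> (s * s)"
        using x y s by (simp only: E(2,3) D(4))
      moreover have "\<tau> (a * d + b * c) = \<tau> a * \<tau> d + \<tau> b * \<tau> c"
        using x y by (simp only: E(2,3) D(4))
      ultimately show "\<tau> (a * c + b * d * (s * s)) + \<tau> (a * d + b * c) * t =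
        \<tau> a * \<tau> c + \<tau> b * \<tau> d * \<tau> (s * s) + (\<tau> a * \<tau> d + \<tau> b * \<tau> c) * t" by simp
    qed
    also have "\<dots> = \<sigma> x * \<sigma> y" using x y by (simp add: \<sigma> algebra_simps flip: t)
    finally show "\<sigma> (x * y) = \<sigma> x * \<sigma> y" .
  qed
  then show ?thesis using that \<sigma> by blast
qed

lemma real_embedding_id: "real_embedding F (\<lambda>x. x)"
  by (simp add: real_embedding_def)

lemma algebraic_int_real_embedding:
  assumes F: "real_subfield F" and \<sigma>: "real_embedding F \<sigma>" and x: "x \<in> F" "algebraic_int x"
  shows "algebraic_int (\<sigma> x)"
proof -
  note D = real_subfieldD[OF F] and E = real_embeddingD[OF \<sigma> F]
  obtain p :: "int poly" where p: "poly (map_poly of_int p) x = 0" "lead_coeff p = 1"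
    using x(2) unfolding algebraic_int_altdef_ipoly by blast
  \<comment> \<open>Membership in \<open>F\<close> is carried through the induction because \<sigma>
    respects sums and products only inside \<open>F\<close>.\<close>
  have "poly (map_poly of_int q) x \<in> F \<and> \<sigma> (poly (map_poly of_int q) x) = poly (map_poly of_int q) (\<sigma> x)"
    for q :: "int poly"
  proof (induction q)
    case (pCons a q)
    define y where "y = poly (map_poly real_of_int q) x"
    have y: "y \<in> F" "\<sigma> y = poly (map_poly of_int q) (\<sigma> x)" using pCons.IH unfolding y_def by auto
    have a: "of_int a \<in> F" "\<sigma> (of_int a) = of_int a"
      using real_subfield_of_int[OF F] real_embedding_of_int[OF \<sigma> F] by auto
    have xy: "x * y \<in> F" using x(1) y(1) by (rule D(4))
    have 1: "poly (map_poly of_int (pCons a q)) x = of_int a + x * y"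
      by (simp add: of_int_hom.map_poly_pCons_hom y_def)
    have 2: "poly (map_poly of_int (pCons a q)) (\<sigma> x) = of_int a + \<sigma> x * \<sigma> y"
      by (simp add: of_int_hom.map_poly_pCons_hom y(2))
    have "\<sigma> (of_int a + x * y) = of_int a + \<sigma> x * \<sigma> y"
      using E(2)[OF a(1) xy] E(3)[OF x(1) y(1)] a(2) by simp
    then show ?case
      using D(3)[OF a(1) xy] unfolding 1 2 by blast
  qed (simp_all add: D(1) E(4))
  from this[of p] have "poly (map_poly of_int p) (\<sigma> x) = 0" using p(1) E(4) by simp
  then show ?thesis using p(2) unfolding algebraic_int_altdef_ipoly by blast
qed

section \<open>Integers of quadratic fields and parity conditions\<close>

lemma squarefree_dvd_square_imp_unit:
  fixes d k u :: int
  assumes "squarefree d" "v ^ 2 dvd d * u ^ 2" "coprime u v"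
  shows "is_unit v"
proof -
  have "coprime (v ^ 2) (u ^ 2)" using assms(3) by (simp add: coprime_commute)
  then have "v ^ 2 dvd d" using assms(2) coprime_dvd_mult_left_iff by blast
  then show ?thesis using assms(1) unfolding squarefree_def by blast
qed

lemma rat_squarefree_mult_square_int:
  fixes d :: int and x :: real
  assumes d: "squarefree d" and x: "x \<in> \<rat>" "of_int d * x ^ 2 \<in> \<int>"
  shows "x \<in> \<int>"
proof -
  obtain u v :: int where uv: "v > 0" "coprime u v" "x = of_int u / of_int v"
    using x(1) by (rule Rats_cases')
  obtain k :: int where "of_int d * x ^ 2 = of_int k" using x(2) by (auto elim: Ints_cases)
  then have "real_of_int (d * u ^ 2) = of_int (k * v ^ 2)"
    using uv by (simp add: field_simps)
  then have "d * u ^ 2 = k * v ^ 2" using of_int_eq_iff by blast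
  then have "is_unit v" using squarefree_dvd_square_imp_unit[OF d _ uv(2)] by simp
  then show ?thesis using uv by auto
qed

lemma sqrt_squarefree_irrational:
  fixes d :: int
  assumes "squarefree d" "d > 1"
  shows "sqrt (of_int d) \<notin> \<rat>"
proof
  assume "sqrt (of_int d) \<in> \<rat>"
  moreover have "algebraic_int (sqrt (of_int d))" by auto
  ultimately have "sqrt (of_int d) \<in> \<int>" using rational_algebraic_int_is_int by blast
  then obtain k :: int where "sqrt (of_int d) = of_int k" by (auto elim: Ints_cases)
  then have "(sqrt (of_int d)) ^ 2 = real_of_int (k ^ 2)" by simp
  then have "real_of_int d = of_int (k ^ 2)" using assms(2) by simp
  then have k: "d = k ^ 2" using of_int_eq_iff by blast
  then have "is_unit k" using assms(1) unfolding squarefree_def by simp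
  then have "d = 1" using k by (auto simp: zdvd1_eq power2_eq_1_iff)
  then show False using assms(2) by simp
qed

lemma rat_adjoin_sqrt: "rat_adjoin {sqrt (of_int d)} = adjoin_sqrt \<rat> (sqrt (of_int d))"
  if "d \<ge> 0"
  using rat_adjoin_insert[of "sqrt (of_int d)" "{}"] that by (simp add: rat_adjoin_empty)

text \<open>The embedding that changes the sign of the square root makes a - b \<surd>d integral as
  well, so trace 2a and norm a^2 - d b^2 are rational integers. Then d (2b)^2 is an integer, and
  squarefreeness of \<open>d\<close> makes 2b one.\<close>

lemma algebraic_int_rat_sqrt:
  fixes d :: int and a b :: real
  assumes d: "squarefree d" "d > 1" and ab: "a \<in> \<rat>" "b \<in> \<rat>"
    and x: "algebraic_int (a + b * sqrt (of_int d))"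
  obtains A B :: int where "2 * a = of_int A" "2 * b = of_int B" "4 dvd A ^ 2 - d * B ^ 2"
proof -
  define s where "s = sqrt (of_int d)"
  have s: "s * s = of_int d" using d by (simp add: s_def)
  have "s \<notin> \<rat>" using sqrt_squarefree_irrational[OF d] by (simp add: s_def)
  then obtain \<sigma> where \<sigma>: "real_embedding (adjoin_sqrt \<rat> s) \<sigma>"
    "\<And>a b. a \<in> \<rat> \<Longrightarrow> b \<in> \<rat> \<Longrightarrow> \<sigma> (a + b * s) = a + b * (- s)"
    using real_embedding_adjoin_sqrt[OF real_subfield_Rats _ _ real_embedding_id, of s "- s"] s
    by auto
  have "algebraic_int (\<sigma> (a + b * s))"
    using ab x s by (intro algebraic_int_real_embedding[OF _ \<sigma>(1)] real_subfield_adjoin_sqrt real_subfield_Rats adjoin_sqrtI)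
      (auto simp: s_def)
  then have conj: "algebraic_int (a - b * s)" using \<sigma>(2) ab by simp
  note x = x[folded s_def]
  have "algebraic_int (2 * a)" using algebraic_int_add_mult(1)[OF x conj] by simp
  then obtain A :: int where A: "2 * a = of_int A"
    using rational_algebraic_int_is_int[of "2 * a"] ab by (auto elim: Ints_cases)
  have "(a + b * s) * (a - b * s) = a ^ 2 - b ^ 2 * (s * s)"
    by (simp add: algebra_simps power2_eq_square)
  then have "algebraic_int (a ^ 2 - of_int d * b ^ 2)"
    using algebraic_int_add_mult(2)[OF x conj] s by (simp add: mult.commute)
  then obtain C :: int where C: "a ^ 2 - of_int d * b ^ 2 = of_int C"
    using rational_algebraic_int_is_int[of "a ^ 2 - of_int d * b ^ 2"] ab by (auto elim: Ints_cases)
  have "of_int d * (2 * b) ^ 2 = (2 * a) ^ 2 - 4 * (a ^ 2 - of_int d * b ^ 2)"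
    by (simp add: power2_eq_square)
  also have "\<dots> = of_int (A ^ 2 - 4 * C)" unfolding A C by simp
  finally have dB: "of_int d * (2 * b) ^ 2 = real_of_int (A ^ 2 - 4 * C)" .
  have "2 * b \<in> \<int>"
  proof (rule rat_squarefree_mult_square_int[OF d(1)])
    show "of_int d * (2 * b) ^ 2 \<in> \<int>" unfolding dB by (rule Ints_of_int)
  qed (use ab in simp)
  then obtain B :: int where B: "2 * b = of_int B" by (auto elim: Ints_cases)
  have "real_of_int (d * B ^ 2) = of_int (A ^ 2 - 4 * C)" using dB B by simp
  then have "d * B ^ 2 = A ^ 2 - 4 * C" using of_int_eq_iff by blast
  then show ?thesis using that A B by simp
qed

lemma square_mod_4: "\<exists>k. x ^ 2 = 4 * k + (if even x then 0 else 1)" for x :: int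
proof (cases "even x")
  case True
  then obtain y where "x = 2 * y" by (rule evenE)
  then show ?thesis by (intro exI[of _ "y ^ 2"]) (simp add: power2_eq_square)
next
  case False
  then obtain y where "x = 2 * y + 1" by (rule oddE)
  then show ?thesis by (intro exI[of _ "y ^ 2 + y"]) (simp add: power2_eq_square algebra_simps)
qed

lemma parity_3_mod_4:
  fixes A B d :: int
  assumes "4 dvd A ^ 2 - d * B ^ 2" "d mod 4 = 3"
  shows "even A \<and> even B"
proof -
  obtain e where e: "d = 4 * e + 3" using assms(2) by (metis mult_div_mod_eq)
  have "A ^ 2 - d * B ^ 2 = A ^ 2 + B ^ 2 - 4 * (e + 1) * B ^ 2" by (simp add: e algebra_simps)
  then have "4 dvd A ^ 2 + B ^ 2" using assms(1) by (metis add.commute diff_add_cancel dvd_add dvd_mult2 dvd_triv_left)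
  moreover obtain k l where "A ^ 2 = 4 * k + (if even A then 0 else 1)" "B ^ 2 = 4 * l + (if even B then 0 else 1)"
    using square_mod_4 by metis
  ultimately show ?thesis
    by (cases "even A"; cases "even B"; simp; presburger)
qed

lemma parity_1_mod_4:
  fixes A B d :: int
  assumes "4 dvd A ^ 2 - d * B ^ 2" "odd d"
  shows "even A \<longleftrightarrow> even B"
proof -
  have "even (A ^ 2 - d * B ^ 2)" using assms(1) by (meson dvd_trans even_numeral)
  then show ?thesis using assms(2) by simp
qed

text \<open>The two congruences come from a relative norm in the biquadratic field. Since squares
  are 0 or 1 modulo 4, the first says that as many of a, d are odd as of b, c; the second excludes
  that the odd ones are exactly a, b or exactly c, d.\<close>

lemma parity_biquadratic:
  fixes a b c d :: int
  assumes 1: "4 dvd a ^ 2 - b ^ 2 - c ^ 2 + d ^ 2" and 2: "even (a * b - c * d)"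
  shows "(even a \<longleftrightarrow> even c) \<and> (even b \<longleftrightarrow> even d)"
proof -
  obtain k l m r where "a ^ 2 = 4 * k + (if even a then 0 else 1)" "b ^ 2 = 4 * l + (if even b then 0 else 1)"
    "c ^ 2 = 4 * m + (if even c then 0 else 1)" "d ^ 2 = 4 * r + (if even d then 0 else 1)"
    using square_mod_4 by metis
  then show ?thesis
    using 1 2 by (cases "even a"; cases "even b"; cases "even c"; cases "even d"; simp; presburger)
qed

section \<open>Totally positive units and classes of indecomposables\<close>

lemma ring_of_integers_closed:
  assumes "real_subfield F" "x \<in> ring_of_integers F" "y \<in> ring_of_integers F"
  shows "x + y \<in> ring_of_integers F" "x * y \<in> ring_of_integers F"
  using assms real_subfieldD(3,4)[OF assms(1)] algebraic_int_add_mult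
  unfolding ring_of_integers_def by auto

lemma totally_positive_integers_closed:
  assumes F: "real_subfield F" and xy: "x \<in> totally_positive_integers F" "y \<in> totally_positive_integers F"
  shows "x + y \<in> totally_positive_integers F" "x * y \<in> totally_positive_integers F"
proof -
  have "x \<in> F" "y \<in> F" using xy by (auto simp: totally_positive_integers_def ring_of_integers_def)
  then have "\<sigma> (x + y) > 0 \<and> \<sigma> (x * y) > 0" if "real_embedding F \<sigma>" for \<sigma>
    using xy that real_embeddingD(2,3)[OF that F] unfolding totally_positive_integers_def by (simp add: add_pos_pos)
  then show "x + y \<in> totally_positive_integers F" "x * y \<in> totally_positive_integers F"
    using xy ring_of_integers_closed[OF F] unfolding totally_positive_integers_def by auto
qed

lemma one_totally_positive_unit:
  assumes "real_subfield F"
  shows "1 \<in> totally_positive_units F"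
proof -
  have "1 \<in> ring_of_integers F"
    unfolding ring_of_integers_def using real_subfieldD(2)[OF assms] by auto
  then show ?thesis
    unfolding totally_positive_units_def integer_units_def totally_positive_integers_def real_embedding_def
    by (auto intro: bexI[of _ 1])
qed

lemma totally_positive_units_mult:
  assumes F: "real_subfield F" and xy: "x \<in> totally_positive_units F" "y \<in> totally_positive_units F"
  shows "x * y \<in> totally_positive_units F"
proof -
  obtain x' y' where x': "x' \<in> ring_of_integers F" "x * x' = 1" and y': "y' \<in> ring_of_integers F" "y * y' = 1"
    using xy unfolding totally_positive_units_def integer_units_def by blast
  have "(x * y) * (x' * y') = (x * x') * (y * y')" by (simp add: mult_ac)
  then have "(x * y) * (x' * y') = 1" using x' y' by simp
  then have "x * y \<in> integer_units F"
    using xy x' y' ring_of_integers_closed[OF F]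
    unfolding integer_units_def totally_positive_units_def by blast
  then show ?thesis
    using xy totally_positive_integers_closed[OF F] unfolding totally_positive_units_def by blast
qed

text \<open>An embedding sends a unit to a nonzero real, whose square is positive. This is the
  source of total positivity for \<epsilon>_r, which is U^2 times a totally positive unit.\<close>

lemma integer_units_square:
  assumes F: "real_subfield F" and x: "x \<in> integer_units F"
  shows "x * x \<in> totally_positive_units F"
proof -
  obtain y where y: "x \<in> ring_of_integers F" "y \<in> ring_of_integers F" "x * y = 1"
    using x unfolding integer_units_def by blast
  have "(x * x) * (y * y) = (x * y) * (x * y)" by (simp add: mult_ac)
  then have "x * x \<in> integer_units F"
    unfolding integer_units_def using y ring_of_integers_closed(2)[OF F] by auto
  moreover have "\<sigma> (x * x) > 0" if "real_embedding F \<sigma>" for \<sigma>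
  proof -
    have xyF: "x \<in> F" "y \<in> F" using y unfolding ring_of_integers_def by auto
    then have "\<sigma> x * \<sigma> y = 1" using real_embeddingD(1,3)[OF that F] y(3) by metis
    then have "\<sigma> x \<noteq> 0" by auto
    then show ?thesis using real_embeddingD(3)[OF that F] xyF by (auto simp: zero_less_mult_iff)
  qed
  ultimately show ?thesis
    unfolding totally_positive_units_def totally_positive_integers_def integer_units_def by blast
qed

lemma totally_positive_unit_inverse:
  assumes F: "real_subfield F" and x: "x \<in> totally_positive_units F"
  obtains y where "y \<in> totally_positive_units F" "x * y = 1"
proof -
  obtain y where y: "x \<in> ring_of_integers F" "y \<in> ring_of_integers F" "x * y = 1"
    using x unfolding totally_positive_units_def integer_units_def by blast
  have "\<sigma> y > 0" if "real_embedding F \<sigma>" for \<sigma>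
  proof -
    have "\<sigma> x * \<sigma> y = 1"
      using real_embeddingD(1,3)[OF that F] y unfolding ring_of_integers_def by (metis (no_types, lifting) mem_Collect_eq)
    moreover have "\<sigma> x > 0" using x that unfolding totally_positive_units_def totally_positive_integers_def by blast
    ultimately show ?thesis using zero_less_mult_pos[of "\<sigma> x" "\<sigma> y"] by simp
  qed
  then have "y \<in> totally_positive_units F"
    unfolding totally_positive_units_def totally_positive_integers_def integer_units_def
    using y by (auto simp: mult.commute)
  then show ?thesis using that y(3) by blast
qed

lemma totally_positive_units_subset: "totally_positive_units F \<subseteq> totally_positive_integers F"
  unfolding totally_positive_units_def by blast

lemma indecomposables_unit_mult:
  assumes F: "real_subfield F" and u: "u \<in> totally_positive_units F" and a: "a \<in> indecomposables F"
  shows "u * a \<in> indecomposables F"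
proof -
  obtain v where v: "v \<in> totally_positive_units F" "u * v = 1"
    using totally_positive_unit_inverse[OF F u] .
  note TP = totally_positive_integers_closed(2)[OF F] and sub = subsetD[OF totally_positive_units_subset]
  have "u * a \<in> totally_positive_integers F"
    using a TP[OF sub[OF u]] unfolding indecomposables_def by blast
  moreover have False
    if bc: "b \<in> totally_positive_integers F" "c \<in> totally_positive_integers F" "u * a = b + c" for b c
  proof -
    have "a = (u * v) * a" using v(2) by simp
    also have "\<dots> = v * (u * a)" by (simp only: mult_ac)
    also have "\<dots> = v * b + v * c" unfolding bc(3) by (simp add: distrib_left)
    finally show False
      using a TP[OF sub[OF v(1)]] bc(1,2) unfolding indecomposables_def by blast
  qed
  ultimately show ?thesis unfolding indecomposables_def by blast
qed

lemma equiv_indecomposable_rel: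
  assumes F: "real_subfield F"
  shows "equiv (indecomposables F) (indecomposable_rel F)"
proof (rule equivI)
  show "indecomposable_rel F \<subseteq> indecomposables F \<times> indecomposables F"
    unfolding indecomposable_rel_def by blast
  show "refl_on (indecomposables F) (indecomposable_rel F)"
    unfolding refl_on_def indecomposable_rel_def
    using one_totally_positive_unit[OF F] by (auto intro!: bexI[of _ 1])
  show "sym (indecomposable_rel F)"
  proof (rule symI)
    fix a b assume "(a, b) \<in> indecomposable_rel F"
    then obtain u where u: "a \<in> indecomposables F" "b \<in> indecomposables F" "u \<in> totally_positive_units F" "b = u * a"
      unfolding indecomposable_rel_def by blast
    obtain v where v: "v \<in> totally_positive_units F" "u * v = 1"
      using totally_positive_unit_inverse[OF F u(3)] .
    have "v * b = (u * v) * a" unfolding u(4) by (simp only: mult_ac)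
    then have "a = v * b" using v(2) by simp
    then show "(b, a) \<in> indecomposable_rel F"
      unfolding indecomposable_rel_def using u v by blast
  qed
  show "trans (indecomposable_rel F)"
  proof (rule transI)
    fix a b c assume "(a, b) \<in> indecomposable_rel F" "(b, c) \<in> indecomposable_rel F"
    then obtain u v where "a \<in> indecomposables F" "c \<in> indecomposables F"
      "u \<in> totally_positive_units F" "v \<in> totally_positive_units F" "c = v * (u * a)"
      unfolding indecomposable_rel_def by blast
    then show "(a, c) \<in> indecomposable_rel F"
      unfolding indecomposable_rel_def using totally_positive_units_mult[OF F]
      by (auto simp: mult.assoc[symmetric])
  qed
qed

lemma complete_set_of_indecomposablesI:
  assumes F: "real_subfield F" and S: "S \<subseteq> indecomposables F"
    and cover: "\<And>a. a \<in> indecomposables F \<Longrightarrow> \<exists>s\<in>S. \<exists>u\<in>totally_positive_units F. a = u * s"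
    and inequivalent: "\<And>s s' u. s \<in> S \<Longrightarrow> s' \<in> S \<Longrightarrow> u \<in> totally_positive_units F \<Longrightarrow> s' = u * s \<Longrightarrow> s = s'"
  shows "complete_set_of_indecomposables F S" "iota F = card S"
proof -
  let ?A = "indecomposables F" and ?r = "indecomposable_rel F"
  have eq: "equiv ?A ?r" by (rule equiv_indecomposable_rel[OF F])
  have r: "(s, a) \<in> ?r \<longleftrightarrow> s \<in> ?A \<and> a \<in> ?A \<and> (\<exists>u\<in>totally_positive_units F. a = u * s)" for s a
    unfolding indecomposable_rel_def by blast
  have ex: "\<exists>s\<in>S. C = ?r `` {s}" if C: "C \<in> indecomposable_classes F" for C
  proof -
    obtain a where a: "a \<in> ?A" "C = ?r `` {a}"
      using C unfolding indecomposable_classes_def by (rule quotientE)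
    obtain s u where s: "s \<in> S" "u \<in> totally_positive_units F" "a = u * s" using cover[OF a(1)] by blast
    have "(s, a) \<in> ?r" unfolding r using s S a by blast
    then have "?r `` {s} = ?r `` {a}" by (rule equiv_class_eq[OF eq])
    then show ?thesis using s a by blast
  qed
  have uniq: "s = s'" if "s \<in> S" "s' \<in> S" "(s, s') \<in> ?r" for s s'
    using that inequivalent unfolding r by blast
  have self: "s \<in> ?r `` {s}" if "s \<in> S" for s
    using equiv_class_self[OF eq] that S by blast
  show "complete_set_of_indecomposables F S"
    unfolding complete_set_of_indecomposables_def
  proof (intro conjI ballI S)
    fix C assume "C \<in> indecomposable_classes F"
    then obtain s where s: "s \<in> S" "C = ?r `` {s}" using ex by blast
    show "\<exists>!s. s \<in> S \<inter> C"
      by (rule ex1I[of _ s]) (use s self uniq in auto)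
  qed
  have "bij_betw (\<lambda>s. ?r `` {s}) S (indecomposable_classes F)"
  proof (rule bij_betwI')
    fix s s' assume s: "s \<in> S" "s' \<in> S"
    show "(?r `` {s} = ?r `` {s'}) = (s = s')"
      using uniq[OF s] self[OF s(2)] by blast
  next
    fix s assume "s \<in> S"
    then show "?r `` {s} \<in> indecomposable_classes F"
      unfolding indecomposable_classes_def using S by (intro quotientI) blast
  next
    fix C assume "C \<in> indecomposable_classes F"
    then show "\<exists>s\<in>S. C = ?r `` {s}" by (rule ex)
  qed
  then show "iota F = card S" unfolding iota_def by (metis bij_betw_same_card)
qed

section \<open>Fundamental units of real quadratic fields\<close>

lemma fundamental_unit_eqI:
  assumes \<epsilon>: "fundamental_unit F \<epsilon>" and u: "u \<in> integer_units F" "u > 1"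
    and least: "\<And>v. v \<in> integer_units F \<Longrightarrow> v > 1 \<Longrightarrow> u \<le> v"
  shows "\<epsilon> = u"
proof -
  have \<epsilon>1: "\<epsilon> \<in> integer_units F" "\<epsilon> > 1" using \<epsilon> unfolding fundamental_unit_def by auto
  obtain k :: int where "u = \<epsilon> powi k \<or> u = - (\<epsilon> powi k)"
    using \<epsilon> u(1) unfolding fundamental_unit_def by blast
  moreover have "\<epsilon> powi k > 0" using \<epsilon>1 by simp
  ultimately have k: "u = \<epsilon> powi k" using u(2) by linarith
  have "k > 0"
  proof (rule ccontr)
    assume "\<not> k > 0"
    then have "\<epsilon> powi k \<le> \<epsilon> powi 0" using \<epsilon>1 by (intro power_int_increasing) auto
    then show False using k u(2) by simp
  qed
  then have "\<epsilon> powi 1 \<le> \<epsilon> powi k" using \<epsilon>1 by (intro power_int_increasing) auto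
  then show ?thesis using k least[OF \<epsilon>1] by simp
qed

text \<open>A unit above 1 of norm 1 or -1 exceeds the absolute value of its conjugate, so A and B
  are positive. From B \<ge> 1 and the norm equation, A^2 \<ge> D - 4 follows, and this forces A
  \<ge> T. Both coordinates are thus at least those of the claimed unit.\<close>

lemma norm_one_unit_lower_bound:
  fixes A B D T :: int
  assumes T: "T \<ge> 5" "D = T ^ 2 - 4" and norm: "\<bar>A ^ 2 - D * B ^ 2\<bar> = 4"
    and u: "(of_int A + of_int B * sqrt (of_int D)) / 2 > 1"
  shows "(of_int T + sqrt (of_int D)) / 2 \<le> (of_int A + of_int B * sqrt (of_int D)) / 2"
proof -
  define w where "w = sqrt (of_int D)"
  have "5 * 5 \<le> T * T" using T(1) by (intro mult_mono) auto
  then have D: "D > 0" unfolding T(2) by (simp add: power2_eq_square)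
  have w: "w > 0" "w * w = of_int D" using D by (simp_all add: w_def)
  define v v' where "v = (of_int A + of_int B * w) / 2" and "v' = (of_int A - of_int B * w) / 2"
  have v: "v > 1" using u by (simp add: v_def w_def)
  have "v * v' = (of_int A ^ 2 - (w * w) * of_int B ^ 2) / 4"
    unfolding v_def v'_def by (simp add: algebra_simps power2_eq_square)
  also have "\<dots> = of_int (A ^ 2 - D * B ^ 2) / 4" unfolding w by simp
  finally have "\<bar>v * v'\<bar> = 1" using norm by (simp only: abs_divide flip: of_int_abs)
  then have "v * \<bar>v'\<bar> = 1" using v by (simp add: abs_mult)
  moreover have "v * \<bar>v'\<bar> \<ge> \<bar>v'\<bar>" using v mult_right_mono[of 1 v "\<bar>v'\<bar>"] by simp
  ultimately have v': "\<bar>v'\<bar> < v" using v by linarith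
  have "real_of_int A = v + v'" "of_int B * w = v - v'" unfolding v_def v'_def by (simp_all add: field_simps)
  then have pos: "0 < real_of_int A" "0 < of_int B * w" using v' by linarith+
  then have A: "A > 0" and B: "B \<ge> 1" using w(1) by (simp_all add: zero_less_mult_iff)
  have "1 \<le> B ^ 2" using B by simp
  then have "D \<le> D * B ^ 2" using D by simp
  then have "A ^ 2 \<ge> D - 4" using norm by linarith
  \<comment> \<open>D - 4 = T^2 - 8 exceeds (T - 1)^2 exactly when 2T > 9, which is the origin of
    the bound 5 on \<open>T\<close>.\<close>
  moreover have "D - 4 > (T - 1) ^ 2" using T by (simp add: power2_eq_square algebra_simps)
  ultimately have "(T - 1) ^ 2 < A ^ 2" by linarith
  then have "T - 1 < A" using A by (simp add: power2_less_imp_less)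
  then have "real_of_int T \<le> of_int A" by simp
  moreover have "1 * w \<le> of_int B * w" using B w by (intro mult_right_mono) auto
  ultimately show ?thesis unfolding w_def by simp
qed

lemma integer_units_quadratic:
  fixes d :: int
  assumes d: "squarefree d" "d > 1" and u: "u \<in> integer_units (rat_adjoin {sqrt (of_int d)})"
  obtains A B :: int where "u = (of_int A + of_int B * sqrt (of_int d)) / 2"
    "4 dvd A ^ 2 - d * B ^ 2" "\<bar>A ^ 2 - d * B ^ 2\<bar> = 4"
proof -
  define s where "s = sqrt (of_int d)"
  have s: "s * s = of_int d" using d by (simp add: s_def)
  have irr: "s \<notin> \<rat>" using sqrt_squarefree_irrational[OF d] by (simp add: s_def)
  have F: "rat_adjoin {sqrt (of_int d)} = adjoin_sqrt \<rat> s" using rat_adjoin_sqrt d by (simp add: s_def)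
  have form: "\<exists>A B. x = (of_int A + of_int B * s) / 2 \<and> 4 dvd A ^ 2 - d * B ^ 2"
    if x: "x \<in> ring_of_integers (adjoin_sqrt \<rat> s)" for x
  proof -
    have "x \<in> adjoin_sqrt \<rat> s" "algebraic_int x" using x by (auto simp: ring_of_integers_def)
    then obtain a b where ab: "a \<in> \<rat>" "b \<in> \<rat>" "x = a + b * s" "algebraic_int (a + b * s)"
      by (metis adjoin_sqrtE)
    obtain A B where AB: "2 * a = of_int A" "2 * b = of_int B" "4 dvd A ^ 2 - d * B ^ 2"
      using algebraic_int_rat_sqrt[OF d ab(1,2) ab(4)[unfolded s_def]] .
    then have "a = of_int A / 2" "b = of_int B / 2" by auto
    then have "x = (of_int A + of_int B * s) / 2" using ab(3) by (simp add: field_simps)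
    then show ?thesis using AB(3) by blast
  qed
  obtain v where v: "u \<in> ring_of_integers (adjoin_sqrt \<rat> s)" "v \<in> ring_of_integers (adjoin_sqrt \<rat> s)" "u * v = 1"
    using u unfolding F integer_units_def by blast
  obtain A B where A: "u = (of_int A + of_int B * s) / 2" "4 dvd A ^ 2 - d * B ^ 2" using form[OF v(1)] by blast
  obtain A' B' where A': "v = (of_int A' + of_int B' * s) / 2" "4 dvd A' ^ 2 - d * B' ^ 2" using form[OF v(2)] by blast
  \<comment> \<open>The last summand is zero because s * s = d. It turns the equation into a
    polynomial identity in a free variable \<open>s\<close>.\<close>
  have "of_int (A * A' + d * (B * B')) + of_int (A * B' + B * A') * s
      = (of_int A + of_int B * s) * (of_int A' + of_int B' * s) + (of_int d - s * s) * of_int B * of_int B'"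
    by (simp add: algebra_simps)
  also have "\<dots> = 4 * (u * v)" unfolding A(1) A'(1) s by simp
  also have "\<dots> = 4 + 0 * s" using v(3) by simp
  finally have "real_of_int (A * A' + d * (B * B')) = 4 \<and> real_of_int (A * B' + B * A') = 0"
    by (rule adjoin_sqrt_unique[OF real_subfield_Rats irr, rotated -1]) auto
  then have prod: "A * A' + d * (B * B') = 4" "A * B' + B * A' = 0"
    by (metis of_int_eq_iff of_int_numeral, metis of_int_eq_0_iff)
  have "(A ^ 2 - d * B ^ 2) * (A' ^ 2 - d * B' ^ 2) = (A * A' + d * (B * B')) ^ 2 - d * (A * B' + B * A') ^ 2"
    by (simp add: algebra_simps power2_eq_square)
  then have norm: "(A ^ 2 - d * B ^ 2) * (A' ^ 2 - d * B' ^ 2) = 16" unfolding prod by simp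
  obtain N N' where N: "A ^ 2 - d * B ^ 2 = 4 * N" "A' ^ 2 - d * B' ^ 2 = 4 * N'"
    using A(2) A'(2) by (auto elim!: dvdE)
  then have "N * N' = 1" using norm by simp
  then have "\<bar>N\<bar> = 1" using abs_zmult_eq_1[of N N'] by simp
  then show ?thesis using that[of A B] A N by (simp add: s_def)
qed

text \<open>The factor \<open>g\<close> unites two shapes of integers: g = 2 if d is 3 modulo 4,
  where parity forces B to be even, and g = 1 for the field of \<surd>q. With B = g b, the norm
  equation of a unit becomes one for D = g^2 d = T^2 - 4, to which the lower bound applies.\<close>

lemma fundamental_unit_quadratic:
  fixes d g T :: int
  assumes d: "squarefree d" "d > 1" and g: "g > 0" "g ^ 2 * d = T ^ 2 - 4" and T: "T \<ge> 5"
    and dvd: "\<And>A B. 4 dvd A ^ 2 - d * B ^ 2 \<Longrightarrow> g dvd B"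
    and \<epsilon>: "fundamental_unit (rat_adjoin {sqrt (of_int d)}) \<epsilon>"
  shows "\<epsilon> = (of_int T + of_int g * sqrt (of_int d)) / 2"
proof (rule fundamental_unit_eqI[OF \<epsilon>])
  define s where "s = sqrt (of_int d)"
  have s: "s * s = of_int d" "s > 0" using d by (simp_all add: s_def)
  have F: "rat_adjoin {sqrt (of_int d)} = adjoin_sqrt \<rat> s" using rat_adjoin_sqrt d by (simp add: s_def)
  have gs: "of_int g * s = sqrt (of_int (g ^ 2 * d))"
    using g(1) by (simp add: s_def real_sqrt_mult)
  have gs2: "(of_int g * s) * (of_int g * s) = of_int T ^ 2 - 4"
  proof -
    have "(of_int g * s) * (of_int g * s) = of_int (g ^ 2 * d)"
      using s(1) by (simp add: power2_eq_square mult_ac)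
    then show ?thesis unfolding g(2) by simp
  qed
  have root: "(of_int T + e * (of_int g * s)) / 2 \<in> ring_of_integers (adjoin_sqrt \<rat> s)" if e: "e = 1 \<or> e = -1" for e
  proof -
    let ?x = "(of_int T + e * (of_int g * s)) / 2"
    let ?f = "[:1, - of_int T, 1:] :: real poly"
    have "algebraic_int ?x"
    proof (rule algebraic_int.intros)
      show "lead_coeff ?f = 1" by simp
      show "\<forall>i. coeff ?f i \<in> \<int>" by (auto simp: coeff_pCons split: nat.splits)
      have "?x * ?x = (of_int T ^ 2 + 2 * e * of_int T * (of_int g * s) + e * e * ((of_int g * s) * (of_int g * s))) / 4"
        by (simp add: algebra_simps power2_eq_square)
      also have "\<dots> = of_int T * ?x - 1" unfolding gs2 using e by (auto simp: field_simps power2_eq_square)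
      finally have *: "?x * ?x = of_int T * ?x - 1" .
      have "poly ?f z = z * z - of_int T * z + 1" for z by (simp add: algebra_simps)
      from this[of ?x] show "poly ?f ?x = 0" unfolding * by simp
    qed
    moreover have "?x \<in> adjoin_sqrt \<rat> s"
      by (rule adjoin_sqrt_cong[of _ "of_int T / 2" "e * of_int g / 2"]) (use e in \<open>auto simp: field_simps\<close>)
    ultimately show ?thesis unfolding ring_of_integers_def by blast
  qed
  have "(of_int T + of_int g * s) / 2 * ((of_int T - of_int g * s) / 2)
      = (of_int T ^ 2 - (of_int g * s) * (of_int g * s)) / 4"
    by (simp add: algebra_simps power2_eq_square)
  also have "\<dots> = 1" unfolding gs2 by simp
  finally have inv: "(of_int T + of_int g * s) / 2 * ((of_int T - of_int g * s) / 2) = 1" .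
  have "(of_int T + of_int g * s) / 2 \<in> integer_units (adjoin_sqrt \<rat> s)"
    unfolding integer_units_def using root[of 1] root[of "-1"] inv
    by (intro CollectI conjI bexI[of _ "(of_int T - of_int g * s) / 2"]) simp_all
  then show "(of_int T + of_int g * sqrt (of_int d)) / 2 \<in> integer_units (rat_adjoin {sqrt (of_int d)})"
    unfolding F by (simp add: s_def)
  have "0 < of_int g * s" using g(1) s(2) by simp
  moreover have "2 < real_of_int T" using T by simp
  ultimately have "2 + 0 < of_int T + of_int g * s" by (rule add_strict_mono[rotated])
  then show "1 < (of_int T + of_int g * sqrt (of_int d)) / 2" by (simp add: s_def)
  fix v assume v: "v \<in> integer_units (rat_adjoin {sqrt (of_int d)})" "v > 1"
  obtain A B where AB: "v = (of_int A + of_int B * s) / 2" "4 dvd A ^ 2 - d * B ^ 2" "\<bar>A ^ 2 - d * B ^ 2\<bar> = 4"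
    using integer_units_quadratic[OF d v(1)] unfolding s_def .
  obtain b where b: "B = g * b" using dvd[OF AB(2)] by (rule dvdE)
  define D where "D = g ^ 2 * d"
  have "\<bar>A ^ 2 - D * b ^ 2\<bar> = 4" using AB(3) unfolding b D_def by (simp add: power_mult_distrib mult_ac)
  moreover have v_eq: "v = (of_int A + of_int b * sqrt (of_int D)) / 2"
    unfolding AB(1) b D_def gs[symmetric] by (simp add: mult_ac)
  ultimately show "(of_int T + of_int g * sqrt (of_int d)) / 2 \<le> v"
    using norm_one_unit_lower_bound[OF T, of D A b] v(2) g(2) gs unfolding D_def s_def by simp
qed

lemma fundamental_unit_sqrt:
  fixes d m :: int
  assumes "squarefree d" "d = m ^ 2 - 1" "d mod 4 = 3" "m \<ge> 3"
    and "fundamental_unit (rat_adjoin {sqrt (of_int d)}) \<epsilon>"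
  shows "\<epsilon> = of_int m + sqrt (of_int d)"
proof -
  have "3 * 3 \<le> m * m" using assms(4) by (intro mult_mono) auto
  then have "d > 1" unfolding assms(2) by (simp add: power2_eq_square)
  then have "\<epsilon> = (of_int (2 * m) + of_int 2 * sqrt (of_int d)) / 2"
    using assms by (intro fundamental_unit_quadratic) (auto simp: parity_3_mod_4)
  then show ?thesis by simp
qed

section \<open>The cone of totally positive integers\<close>

text \<open>This is the integral decomposition of a Minkowski sum: a lattice point of A times one
  hexagon plus B times the other is a sum of lattice points of the two summands. The ten bounds are
  the edge inequalities of the sum, (\<xi>, \<eta>) is the point after a translation, and
  \<open>h\<close> and \<open>g\<close> determine the rows A - h and B + g of the two
  pieces.\<close>

lemma lattice_split:
  fixes m A B \<xi> \<eta> :: int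
  assumes m: "m \<ge> 2" and AB: "A \<ge> 0" "B \<ge> 0"
    and y: "- \<eta> \<le> A + B" "\<eta> \<le> A + (m + 1) * B"
    and x: "\<xi> \<le> A + B" "- \<xi> \<le> (m + 1) * A + B"
    and xmy: "- m * A - (m - 1) * B \<le> \<xi> + m * \<eta>" "\<xi> + m * \<eta> \<le> (m * m + m - 1) * B"
    and xy: "- m * A \<le> \<xi> + \<eta>" "\<xi> + \<eta> \<le> m * B"
    and mxy: "- (m * m + m - 1) * A \<le> m * \<xi> + \<eta>" "m * \<xi> + \<eta> \<le> (m - 1) * A + m * B"
  shows "\<exists>h g. - A \<le> h \<and> h \<le> A \<and> - B \<le> g \<and> g \<le> B \<and>
    max h (m * h) - m * A \<le> \<xi> + g \<and> \<xi> + g \<le> min h (m * h) \<and>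
    max g (m * g) \<le> \<eta> + h \<and> \<eta> + h \<le> m * B + min g (m * g)"
proof -
  have nonneg: "0 \<le> (m - 1) * A" "0 \<le> (m - 1) * B" using m AB by auto
  have mono: "(m - 1) * a \<le> (m - 1) * b" if "a \<le> b" for a b :: int
    using m that by (simp add: mult_left_mono)
  \<comment> \<open>The constraints on \<open>h\<close> and \<open>g\<close> in terms of \<open>h\<close>, \<open>- g\<close> and \<open>D = h - g\<close>:
      for fixed \<open>D\<close> both \<open>h\<close> and \<open>- g\<close> range over intervals containing \<open>0\<close>.\<close>
  have *: ?thesis if "- A \<le> h" "h \<le> A" "- B \<le> g" "g \<le> B"
    "\<xi> \<le> h - g" "- \<eta> \<le> h - g" "h - g \<le> \<xi> + m * A" "h - g \<le> m * B - \<eta>"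
    "\<xi> - (h - g) \<le> (m - 1) * h" "(m - 1) * h \<le> \<xi> + m * A - (h - g)"
    "- \<eta> - (h - g) \<le> - ((m - 1) * g)" "- ((m - 1) * g) \<le> m * B - \<eta> - (h - g)" for h g
    using that by (intro exI[of _ h] exI[of _ g]) (auto simp: algebra_simps)
  \<comment> \<open>D must lie between max(\<xi>, -\<eta>) and min(\<xi> + m A, m B - \<eta>), an
    interval that is nonempty by \<open>xy\<close>. The cases take D = 0 if possible and otherwise
    the end nearest to 0. In D = h + (-g), the end attained by a bound in \<xi> is filled by
    \<open>h\<close> first, up to A in absolute value; for \<eta> it is filled by \<open>g\<close>
    first, up to B.\<close>
  consider "\<xi> \<le> 0" "- \<eta> \<le> 0" "0 \<le> \<xi> + m * A" "0 \<le> m * B - \<eta>"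
    | "- \<eta> \<le> \<xi>" "0 < \<xi>" | "\<xi> \<le> - \<eta>" "0 < - \<eta>"
    | "\<xi> + m * A \<le> m * B - \<eta>" "\<xi> + m * A < 0" | "m * B - \<eta> \<le> \<xi> + m * A" "m * B - \<eta> < 0"
    by linarith
  then show ?thesis
  proof cases
    case 1
    then show ?thesis using AB by (intro *[of 0 0]) auto
  next
    case 2
    show ?thesis
    proof (cases "\<xi> \<le> A")
      case True
      then show ?thesis using 2 AB xy mono[OF True] mono[of 0 \<xi>]
        by (intro *[of \<xi> 0]) (auto simp: algebra_simps)
    next
      case False
      then show ?thesis using 2 AB x xy mxy nonneg mono[of 0 "\<xi> - A"]
        by (intro *[of A "A - \<xi>"]) (auto simp: algebra_simps)
    qed
  next
    case 3
    show ?thesis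
    proof (cases "- \<eta> \<le> B")
      case True
      then show ?thesis using 3 AB xy mono[OF True] mono[of 0 "- \<eta>"]
        by (intro *[of 0 \<eta>]) (auto simp: algebra_simps)
    next
      case False
      then show ?thesis using 3 AB y xy xmy nonneg mono[of 0 "- \<eta> - B"]
        by (intro *[of "- \<eta> - B" "- B"]) (auto simp: algebra_simps)
    qed
  next
    case 4
    define D where "D = \<xi> + m * A"
    show ?thesis
    proof (cases "- A \<le> D")
      case True
      then show ?thesis using 4 AB xy mono[OF True] mono[of D 0]
        by (intro *[of D 0]) (auto simp: D_def algebra_simps)
    next
      case False
      then show ?thesis using 4 AB x xy mxy nonneg mono[of 0 "- A - D"]
        by (intro *[of "- A" "- A - D"]) (auto simp: D_def algebra_simps)
    qed
  next
    case 5
    define D where "D = m * B - \<eta>"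
    show ?thesis
    proof (cases "- B \<le> D")
      case True
      then show ?thesis using 5 AB xy mono[OF True] mono[of D 0]
        by (intro *[of 0 "- D"]) (auto simp: D_def algebra_simps)
    next
      case False
      then show ?thesis using 5 AB y xy xmy nonneg mono[of 0 "- B - D"]
        by (intro *[of "D + B" B]) (auto simp: D_def algebra_simps)
    qed
  qed
qed

section \<open>Coordinates and the semigroup generated by the candidates\<close>

type_synonym quad = "int \<times> int \<times> int \<times> int"

text \<open>Evaluating one integer vector at (P, Q), (P', Q), (P, Q') and (P', Q') gives the four
  conjugates of an element, so total positivity becomes four inequalities about the same
  vector.\<close>

definition qval :: "real \<Rightarrow> real \<Rightarrow> quad \<Rightarrow> real" where
  "qval x y = (\<lambda>(a, b, c, d). of_int a + of_int b * x + of_int c * y + of_int d * x * y)"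

text \<open>
  \<open>E\<close> plays the role of the group of totally positive units. The elements in the last assumption are
  \<open>\<epsilon>\<^sub>r\<close> and its inverse.
\<close>

locale biquadratic_units =
  fixes n :: int and P P' Q Q' :: real and E :: "real set"
  assumes n: "n \<ge> 2"
    and P: "P + P' = 4 * of_int n" "P * P' = 1"
    and Q: "Q + Q' = 4 * of_int n - 1" "Q * Q' = 1"
    and ord: "1 < Q" "Q < P"
    and E1: "1 \<in> E" and E_mult: "\<And>x y. x \<in> E \<Longrightarrow> y \<in> E \<Longrightarrow> x * y \<in> E"
    and PQ_E: "P \<in> E" "P' \<in> E" "Q \<in> E" "Q' \<in> E"
    and R_E: "(P * Q - 1) * (P * Q - 1) * (P' * Q') \<in> E"
      "(Q' - P') * (Q' - P') * (P * Q) \<in> E"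
begin

definition U where "U = P * Q - 1"

definition U' where "U' = Q' - P'"

lemma P'_eq: "P' = 4 * of_int n - P" and Q'_eq: "Q' = 4 * of_int n - 1 - Q"
  using P Q by auto

lemma sq_P: "P * P = 4 * of_int n * P - 1" and sq_Q: "Q * Q = (4 * of_int n - 1) * Q - 1"
  using P Q by (auto simp: P'_eq Q'_eq algebra_simps)

lemma sq_P': "P' * P' = 4 * of_int n * P' - 1" and sq_Q': "Q' * Q' = (4 * of_int n - 1) * Q' - 1"
proof -
  have "P' * (P + P') = 4 * of_int n * P'" using P(1) by simp
  then show "P' * P' = 4 * of_int n * P' - 1" using P(2) by (simp add: algebra_simps)
  have "Q' * (Q + Q') = (4 * of_int n - 1) * Q'" using Q(1) by simp
  then show "Q' * Q' = (4 * of_int n - 1) * Q' - 1" using Q(2) by (simp add: algebra_simps)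
qed

lemma U'_eq: "U' = P - Q - 1" "U' = 4 * of_int n - 1 - Q - P'"
  unfolding U'_def using P Q by auto

lemma UU': "U * U' = 1"
proof -
  have "U * U' = P * (Q * Q') - Q * (P * P') - Q' + P'"
    unfolding U_def U'_def by (simp add: algebra_simps)
  then show ?thesis using P Q by simp
qed

lemma inverse_bounds: "0 < P'" "P' < Q'" "Q' < 1"
proof -
  have "P' = 1 / P" "Q' = 1 / Q"
    using P Q ord nonzero_eq_divide_eq[of P P' 1] nonzero_eq_divide_eq[of Q Q' 1]
    by (auto simp: mult.commute)
  then show "0 < P'" "P' < Q'" "Q' < 1"
    using ord frac_less2[of 1 1 Q P] by auto
qed

lemma product_bounds: "1 < P * Q" "P' * Q < 1" "1 < P * Q'" "P' * Q' < 1"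
proof -
  note pos = ord inverse_bounds
  show "1 < P * Q" using pos mult_strict_mono[of 1 P 1 Q] by simp
  show "P' * Q < 1" using mult_strict_left_mono[of Q P P'] P pos by (simp add: mult.commute)
  show "1 < P * Q'" using mult_strict_right_mono[of Q P Q'] Q pos by simp
  show "P' * Q' < 1" using mult_strict_mono[of P' 1 Q' 1] pos by simp
qed

text \<open>An indecomposable element of this set cannot have been obtained by the rule
  \<open>add\<close>; completeness of the list is read off from the other two rules.\<close>

inductive_set gen :: "real set" where
  unit: "\<eta> \<in> E \<Longrightarrow> \<eta> \<in> gen"
| cone: "\<eta> \<in> E \<Longrightarrow> 1 \<le> k \<Longrightarrow> k \<le> 4 * n - 2 \<Longrightarrow> \<eta> * (U * (of_int k - P')) \<in> gen"
| add: "x \<in> gen \<Longrightarrow> y \<in> gen \<Longrightarrow> x + y \<in> gen"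

lemma gen_mult: "x \<in> gen \<Longrightarrow> \<eta> \<in> E \<Longrightarrow> \<eta> * x \<in> gen"
proof (induction rule: gen.induct)
  case (cone \<theta> k)
  then show ?case using gen.cone[of "\<eta> * \<theta>" k] E_mult by (simp add: mult.assoc)
qed (auto simp: distrib_left intro: gen.intros E_mult)

definition gen0 where "gen0 = insert 0 gen"

lemma gen0_add: "x \<in> gen0 \<Longrightarrow> y \<in> gen0 \<Longrightarrow> x + y \<in> gen0"
  unfolding gen0_def by (auto intro: gen.add)

lemma gen0_mult: "x \<in> gen0 \<Longrightarrow> \<eta> \<in> E \<Longrightarrow> \<eta> * x \<in> gen0"
  unfolding gen0_def by (auto intro: gen_mult)

lemma gen0_unit: "\<eta> \<in> E \<Longrightarrow> \<eta> \<in> gen0"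
  unfolding gen0_def by (auto intro: gen.unit)

lemma gen0_scale:
  assumes "x \<in> gen0" "k \<ge> 0"
  shows "of_int k * x \<in> gen0"
proof -
  have "of_nat j * x \<in> gen0" for j
    by (induction j) (use assms(1) in \<open>auto simp: gen0_def distrib_right intro: gen.add\<close>)
  from this[of "nat k"] show ?thesis using assms(2) by simp
qed

text \<open>Writing 1 as U U' factors the point as U (k - P') with k = x + 4n - 1. Here k runs from
  1 to 4n - 1, one value beyond the range allowed in \<open>gen\<close>.\<close>

lemma middle_point:
  assumes "- (4 * n - 2) \<le> x" "x \<le> 0"
  shows "1 + (of_int x + Q) * U \<in> gen"
proof -
  have "1 + (of_int x + Q) * U = U * U' + (of_int x + Q) * U" by (simp add: UU')
  also have "\<dots> = U * (of_int (x + 4 * n - 1) - P')"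
    unfolding U'_eq(2) by (simp add: algebra_simps)
  finally have eq: "1 + (of_int x + Q) * U = U * (of_int (x + 4 * n - 1) - P')" .
  show ?thesis
  proof (cases "x = 0")
    case True
    \<comment> \<open>For k = 4n - 1 one has k - P' = P - 1 = P (1 - P'), so this end of the row is
      P times the other end, k = 1.\<close>
    have "P * (U * (1 - P')) = U * (P - P * P')" by (simp add: algebra_simps)
    also have "\<dots> = U * (of_int (x + 4 * n - 1) - P')"
      using True P by (simp add: P'_eq algebra_simps)
    finally have "P * (U * (of_int 1 - P')) = 1 + (of_int x + Q) * U" unfolding eq by simp
    moreover have "P * (U * (of_int 1 - P')) \<in> gen" using gen.cone[of P 1] PQ_E n by simp
    ultimately show ?thesis by simp
  next
    case False
    then show ?thesis using gen.cone[of 1 "x + 4 * n - 1"] E1 assms unfolding eq by simp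
  qed
qed

text \<open>An integer between -(4n - 2) r and 0 is a sum of r integers between -(4n - 2) and 0. The
  induction splits one off greedily, taking \<open>x1\<close> as negative as allowed.\<close>

lemma middle_points:
  assumes "- ((4 * n - 2) * r) \<le> x" "x \<le> 0" "r \<ge> 0"
  shows "of_int r + (of_int x + of_int r * Q) * U \<in> gen0"
proof -
  have "\<And>x. - ((4 * n - 2) * int j) \<le> x \<Longrightarrow> x \<le> 0 \<Longrightarrow> of_nat j + (of_int x + of_nat j * Q) * U \<in> gen0" for j
  proof (induction j)
    case 0
    then show ?case by (simp add: gen0_def)
  next
    case (Suc j)
    define x1 where "x1 = max x (- (4 * n - 2))"
    have "1 + (of_int x1 + Q) * U \<in> gen0"
      using middle_point[of x1] Suc.prems n unfolding x1_def gen0_def by auto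
    moreover have "of_nat j + (of_int (x - x1) + of_nat j * Q) * U \<in> gen0"
    proof (rule Suc.IH)
      have "0 \<le> (4 * n - 2) * int j" using n by simp
      then show "- ((4 * n - 2) * int j) \<le> x - x1" "x - x1 \<le> 0"
        using Suc.prems unfolding x1_def by (auto simp: algebra_simps max_def)
    qed
    ultimately have "(1 + (of_int x1 + Q) * U) + (of_nat j + (of_int (x - x1) + of_nat j * Q) * U) \<in> gen0"
      by (rule gen0_add)
    then show ?case by (simp add: algebra_simps)
  qed
  from this[of "nat r" x] show ?thesis using assms by simp
qed

text \<open>
  \<open>(x, A - h)\<close> is a lattice point of \<open>A\<close> times the hexagon with vertices
  \<open>(0, 0), (1, 0), (0, 1), (-m, 2), (-m - 1, 2), (-m, 1)\<close>; the lattice points of the hexagon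
  other than its middle row \<open>(-m, 1), \<dots>, (0, 1)\<close> correspond to units.
\<close>

lemma polygon_points:
  assumes h: "- A \<le> h" "h \<le> A" and m: "m = 4 * n - 2"
    and x: "max h (m * h) - m * A \<le> x" "x \<le> min h (m * h)"
  shows "of_int A + (of_int x + of_int (A - h) * Q) * U \<in> gen0"
proof (cases "h \<ge> 0")
  case True
  \<comment> \<open>A point in row A - h is built from A - h points of the middle row and h points
    of the bottom row. Of the latter, x' are (1, 0), which is PQ, and the others are (0, 0), which
    is 1.\<close>
  define x' where "x' = max 0 x"
  have m0: "m \<ge> 2" using m n by simp
  have hmh: "h \<le> m * h" using mult_right_mono[of 1 m h] True m0 by simp
  have mAh: "0 \<le> m * (A - h)" using m0 h by simp
  have "of_int (A - h) + (of_int (x - x') + of_int (A - h) * Q) * U \<in> gen0"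
    by (rule middle_points)
      (use x mAh h hmh m in \<open>auto simp: x'_def algebra_simps max_def\<close>)
  moreover have "of_int (h - x') * 1 \<in> gen0"
    by (rule gen0_scale[OF gen0_unit[OF E1]]) (use x True hmh in \<open>auto simp: x'_def\<close>)
  moreover have "of_int x' * (P * Q) \<in> gen0"
    by (rule gen0_scale[OF gen0_unit[OF E_mult]]) (use PQ_E in \<open>auto simp: x'_def\<close>)
  ultimately have "(of_int (A - h) + (of_int (x - x') + of_int (A - h) * Q) * U)
      + (of_int (h - x') * 1 + of_int x' * (P * Q)) \<in> gen0"
    by (rule gen0_add[OF _ gen0_add])
  then show ?thesis unfolding U_def by (simp add: algebra_simps)
next
  case False
  define g where "g = - h"
  have m0: "m \<ge> 2" using m n by simp
  have g: "g > 0" "g \<le> A" using False h unfolding g_def by auto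
  have mg: "g \<le> m * g" using mult_right_mono[of 1 m g] g m0 by simp
  have mAg: "0 \<le> m * (A - g)" using m0 g by simp
  have x: "- g - m * A \<le> x" "x \<le> - (m * g)"
    using x mg unfolding g_def by (auto simp: max_def min_def split: if_splits)
  \<comment> \<open>Now g points come from the top row and A - g from the middle row.
    \<open>x1\<close> is the total abscissa of the middle points, and \<open>x2\<close> counts the
    top points at (-m - 1, 2) instead of (-m, 2).\<close>
  define x1 where "x1 = max (x + m * g) (- (m * (A - g)))"
  define x2 where "x2 = x1 - (x + m * g)"
  have x2: "0 \<le> x2" "x2 \<le> g" using x g mAg unfolding x1_def x2_def by (auto simp: algebra_simps)
  \<comment> \<open>Since U^2 = P Q \<epsilon>_r, these two top vertices are the units P
    \<epsilon>_r and Q \<epsilon>_r.\<close>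
  have top1: "U * U * Q' = 1 + (2 * Q - of_int m) * U" and top2: "U * U * P' = 1 + (2 * Q - of_int m - 1) * U"
  proof -
    have "U * Q' = P * (Q * Q') - Q'" unfolding U_def by (simp add: algebra_simps)
    also have "\<dots> = P - Q'" using Q by simp
    finally have 1: "U * Q' = P - Q'" .
    have "U * P' = Q * (P * P') - P'" unfolding U_def by (simp add: algebra_simps)
    also have "\<dots> = Q - P'" using P by simp
    finally have 2: "U * P' = Q - P'" .
    have "1 + (2 * Q - of_int m) * U = U * (U' + 2 * Q - of_int m)"
      using UU' by (simp add: algebra_simps)
    also have "\<dots> = U * (U * Q')" unfolding 1 U'_eq(1) by (simp add: Q'_eq m)
    finally show "U * U * Q' = 1 + (2 * Q - of_int m) * U" by simp
    have "1 + (2 * Q - of_int m - 1) * U = U * (U' + 2 * Q - of_int m - 1)"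
      using UU' by (simp add: algebra_simps)
    also have "\<dots> = U * (U * P')" unfolding 2 U'_eq(1) by (simp add: P'_eq m)
    finally show "U * U * P' = 1 + (2 * Q - of_int m - 1) * U" by simp
  qed
  have "P * (U * U * (P' * Q')) \<in> E" "Q * (U * U * (P' * Q')) \<in> E"
    using R_E(1) PQ_E E_mult unfolding U_def by blast+
  moreover have "P * (U * U * (P' * Q')) = (P * P') * (U * U * Q')"
    "Q * (U * U * (P' * Q')) = (Q * Q') * (U * U * P')" by (simp_all add: mult_ac)
  ultimately have tops: "U * U * Q' \<in> E" "U * U * P' \<in> E" using P Q by simp_all
  have "of_int (A - g) + (of_int x1 + of_int (A - g) * Q) * U \<in> gen0"
    by (rule middle_points[folded m])
      (use x mAg g mg in \<open>auto simp: x1_def algebra_simps max_def\<close>)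
  moreover have "of_int (g - x2) * (U * U * Q') \<in> gen0" "of_int x2 * (U * U * P') \<in> gen0"
    by (rule gen0_scale[OF gen0_unit]; use tops x2 in simp)+
  ultimately have "(of_int (A - g) + (of_int x1 + of_int (A - g) * Q) * U)
      + (of_int (g - x2) * (U * U * Q') + of_int x2 * (U * U * P')) \<in> gen0"
    by (rule gen0_add[OF _ gen0_add])
  then show ?thesis unfolding top1 top2 x2_def g_def by (simp add: algebra_simps)
qed

text \<open>The inequalities describe the cone over the facet \<open>L = 1\<close>, in which \<open>A + B\<close> is the value of \<open>L\<close>.\<close>

lemma facet_cone_points:
  assumes m: "m = 4 * n - 2" and AB: "A \<ge> 0" "B \<ge> 0"
    and y: "0 \<le> y" "y \<le> 2 * A + (m + 2) * B"
    and x: "x \<le> A" "0 \<le> (m + 1) * A + 2 * B + x"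
    and xmy: "0 \<le> x + m * y" "x + m * y \<le> m * A + (m * m + 2 * m - 2) * B"
    and xy: "0 \<le> (m - 1) * A + x + y" "x + y \<le> A + m * B"
    and mxy: "0 \<le> (m * m + m - 2) * A + (m - 1) * B + m * x + y" "m * x + y \<le> m * A + B"
  shows "of_int A + of_int B * Q + (of_int x + of_int y * Q) * U \<in> gen0"
proof -
  have "m \<ge> 2" using m n by simp
  then have "\<exists>h g. - A \<le> h \<and> h \<le> A \<and> - B \<le> g \<and> g \<le> B \<and>
      max h (m * h) - m * A \<le> (x + B) + g \<and> (x + B) + g \<le> min h (m * h) \<and>
      max g (m * g) \<le> (y - A - B) + h \<and> (y - A - B) + h \<le> m * B + min g (m * g)"
    by (rule lattice_split) (use AB y x xmy xy mxy in \<open>auto simp: algebra_simps\<close>)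
  then obtain h g where hg: "- A \<le> h" "h \<le> A" "- B \<le> g" "g \<le> B"
    and h: "max h (m * h) - m * A \<le> x + B + g" "x + B + g \<le> min h (m * h)"
    and g: "max g (m * g) \<le> y - A - B + h" "y - A - B + h \<le> m * B + min g (m * g)"
    by blast
  \<comment> \<open>The second summand is Q times a point of B times the first hexagon, in row B +
    g. By Q^2 = (m + 1) Q - 1, this row contributes -(B + g) to the coefficient of U, cancelled by
    the shift x + B + g in the first summand, and (m + 1)(B + g) to that of QU, which
    \<open>z\<close> subtracts.\<close>
  define z where "z = y - A + h - (m + 1) * (B + g)"
  have "of_int A + (of_int (x + B + g) + of_int (A - h) * Q) * U \<in> gen0"
    by (rule polygon_points[OF hg(1,2) m h])
  moreover have "Q * (of_int B + (of_int z + of_int (B - (- g)) * Q) * U) \<in> gen0"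
  proof (rule gen0_mult[OF polygon_points[OF _ _ m]])
    show "max (- g) (m * (- g)) - m * B \<le> z" "z \<le> min (- g) (m * (- g))"
      using g unfolding z_def by (auto simp: algebra_simps max_def min_def split: if_splits)
  qed (use hg PQ_E in auto)
  ultimately have "(of_int A + (of_int (x + B + g) + of_int (A - h) * Q) * U)
      + Q * (of_int B + (of_int z + of_int (B - (- g)) * Q) * U) \<in> gen0"
    by (rule gen0_add)
  also have "Q * (of_int B + (of_int z + of_int (B - (- g)) * Q) * U)
      = of_int B * Q + (of_int z * Q + of_int (B + g) * (Q * Q)) * U"
    by (simp add: algebra_simps)
  also have "\<dots> = of_int B * Q + (of_int z * Q + of_int (B + g) * ((of_int m + 1) * Q - 1)) * U"
    unfolding sq_Q by (simp add: m)
  finally show ?thesis unfolding z_def by (simp add: algebra_simps)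
qed

section \<open>Multiplication in coordinates and the two positive forms\<close>

definition qmul :: "quad \<Rightarrow> quad \<Rightarrow> quad" where
  "qmul = (\<lambda>(a, b, c, d) (e, f, g, h).
    (a * e - b * f - c * g + d * h,
     a * f + b * (e + 4 * n * f) - c * h - d * (g + 4 * n * h),
     a * g - b * h + c * (e + (4 * n - 1) * g) - d * (f + (4 * n - 1) * h),
     a * h + b * (g + 4 * n * h) + c * (f + (4 * n - 1) * h)
       + d * (e + (4 * n - 1) * g + 4 * n * f + 4 * n * (4 * n - 1) * h)))"

text \<open>Only the quadratic equations of x and y enter, and P, P' satisfy the same one, as do Q,
  Q'. One table therefore serves all four conjugates.\<close>

lemma qval_qmul:
  assumes x: "x * x = 4 * of_int n * x - 1" and y: "y * y = (4 * of_int n - 1) * y - 1"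
  shows "qval x y (qmul v w) = qval x y v * qval x y w"
proof -
  obtain a b c d where v: "v = (a, b, c, d)" by (cases v)
  obtain e f g h where w: "w = (e, f, g, h)" by (cases w)
  have prod: "(\<alpha> + \<beta> * x) * (\<gamma> + \<delta> * x) =
      (\<alpha> * \<gamma> - \<beta> * \<delta>) + (\<alpha> * \<delta> + \<beta> * \<gamma> + 4 * of_int n * \<beta> * \<delta>) * x" for \<alpha> \<beta> \<gamma> \<delta> :: real
  proof -
    have "(\<alpha> + \<beta> * x) * (\<gamma> + \<delta> * x) = \<alpha> * \<gamma> + (\<alpha> * \<delta> + \<beta> * \<gamma>) * x + \<beta> * \<delta> * (x * x)"
      by (simp add: algebra_simps)
    then show ?thesis unfolding x by (simp add: algebra_simps)
  qed
  have "qval x y v * qval x y w =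
      (a + b * x) * (e + f * x) + ((a + b * x) * (g + h * x) + (c + d * x) * (e + f * x)) * y
      + (c + d * x) * (g + h * x) * (y * y)"
    unfolding v w qval_def by (simp add: algebra_simps)
  also have "\<dots> = qval x y (qmul v w)"
    unfolding v w qval_def qmul_def prod y by (simp add: algebra_simps)
  finally show ?thesis ..
qed

definition qpos :: "quad \<Rightarrow> bool" where
  "qpos w \<longleftrightarrow> 0 < qval P Q w \<and> 0 < qval P' Q w \<and> 0 < qval P Q' w \<and> 0 < qval P' Q' w"

definition L :: "quad \<Rightarrow> int" where
  "L = (\<lambda>(a, b, c, d). a + (4 * n - 2) * b + c + d)"

definition M :: "quad \<Rightarrow> int" where
  "M = (\<lambda>(a, b, c, d). a + b + c + d)"

text \<open>
  \<open>L\<close> is the trace form of a totally positive element of the codifferent: since \<open>L\<close> vanishes on \<open>U\<close> and \<open>Q U\<close>,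
  this element is \<open>\<surd>p / U\<close> times an element of \<open>\<rat>(\<surd>q)\<close>, which yields the weights in the proof.
\<close>

lemma L_pos:
  assumes "qpos w"
  shows "0 < L w"
proof -
  obtain a b c d where w: "w = (a, b, c, d)" by (cases w)
  have m: "4 * of_int n - 2 = Q + Q' - 1" using Q by simp
  \<comment> \<open>The second summand is a multiple of Q Q' - 1 and hence zero. It is chosen so
    that the equation with the conjugates becomes a polynomial identity in P, P', Q, Q' without
    relations. The resulting weights are positive because P' < Q' < 1 < Q < P.\<close>
  have "(Q + 1) * (P - P') * of_int (L w) =
      (Q + 1) * (P - P') * (a + (Q + Q' - 1) * b + c + d) + (Q * Q' - 1) * (P - P') * (c + d * (1 + Q) - b)"
    unfolding w L_def using Q(2) by (simp flip: m)
  also have "\<dots> =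
      (Q' - P') * qval P Q w + (P - Q') * qval P' Q w + Q * (Q - P') * qval P Q' w + Q * (P - Q) * qval P' Q' w"
    unfolding w qval_def by (simp add: algebra_simps)
  also have "\<dots> > 0"
    using assms ord inverse_bounds unfolding qpos_def
    by (intro add_pos_pos mult_pos_pos) auto
  finally have "0 < (Q + 1) * (P - P') * of_int (L w)" .
  moreover have "(Q + 1) * (P - P') > 0" using ord inverse_bounds by simp
  ultimately show ?thesis by (simp add: zero_less_mult_iff)
qed

text \<open>\<open>M\<close> is the trace of w / ((P + 1)(Q + 1)): from 1 / (P' + 1) = P / (P + 1),
  and likewise for Q, the conjugates carry the weights 1, P, Q, PQ over the common denominator (P +
  1)(Q + 1).\<close>

lemma M_pos:
  assumes "qpos w"
  shows "0 < M w"
proof -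
  obtain a b c d where w: "w = (a, b, c, d)" by (cases w)
  have "(P + 1) * (Q + 1) * of_int (M w) =
      (P + 1) * (Q + 1) * (a + b + c + d) + (P * P' - 1) * (1 + Q) * b + (Q * Q' - 1) * (1 + P) * c
      + ((P * P' - 1) * Q + (Q * Q' - 1) * P + ((P * P') * (Q * Q') - 1)) * d"
    unfolding w M_def using P(2) Q(2) by simp
  also have "\<dots> = qval P Q w + P * qval P' Q w + Q * qval P Q' w + P * Q * qval P' Q' w"
    unfolding w qval_def by (simp add: algebra_simps)
  also have "\<dots> > 0"
    using assms ord unfolding qpos_def by (intro add_pos_pos mult_pos_pos) auto
  finally have "0 < (P + 1) * (Q + 1) * of_int (M w)" .
  moreover have "(P + 1) * (Q + 1) > 0" using ord by simp
  ultimately show ?thesis by (simp add: zero_less_mult_iff)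
qed

lemma qpos_qmul: "qpos v \<Longrightarrow> qpos w \<Longrightarrow> qpos (qmul v w)"
  unfolding qpos_def
  by (simp add: qval_qmul sq_P sq_P' sq_Q sq_Q')

text \<open>The inverse, rather than the value itself, is required to lie in \<open>E\<close>, since
  it is the factor that carries a decomposition of the product back to \<open>w\<close>.\<close>

definition qunit :: "quad \<Rightarrow> bool" where
  "qunit e \<longleftrightarrow> qpos e \<and> (\<exists>t\<in>E. qval P Q e * t = 1)"

lemma qunit_qmul: "qunit e \<Longrightarrow> qunit f \<Longrightarrow> qunit (qmul e f)"
proof -
  assume "qunit e" "qunit f"
  then obtain s t where st: "qpos e" "qpos f" "s \<in> E" "t \<in> E" "qval P Q e * s = 1" "qval P Q f * t = 1"
    unfolding qunit_def by blast
  have "qval P Q (qmul e f) * (s * t) = (qval P Q e * s) * (qval P Q f * t)"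
    by (simp add: qval_qmul sq_P sq_Q)
  then show ?thesis unfolding qunit_def using st qpos_qmul E_mult by auto
qed

definition eP :: quad where "eP = (0, 1, 0, 0)"
definition eP' :: quad where "eP' = (4 * n, -1, 0, 0)"
definition eQ :: quad where "eQ = (0, 0, 1, 0)"
definition eQ' :: quad where "eQ' = (4 * n - 1, 0, -1, 0)"
text \<open>\<epsilon>_r = U^2 P' Q' equals P Q + P' Q' - 2, expanded here by P' = 4n - P and Q' =
  4n - 1 - Q. In the same way \<open>eR'\<close> is the inverse P Q' + P' Q - 2.\<close>

definition eR :: quad where "eR = (4 * n * (4 * n - 1) - 2, 1 - 4 * n, - 4 * n, 2)"
definition eR' :: quad where "eR' = (-2, 4 * n - 1, 4 * n, -2)"

lemma qval_eR:
  assumes "x + x' = 4 * of_int n" "x * x' = 1" "y + y' = 4 * of_int n - 1" "y * y' = 1"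
  shows "qval x y eR = (x * y - 1) * (x * y - 1) * (x' * y')"
    and "qval x y eR' = (y' - x') * (y' - x') * (x * y)"
proof -
  have x': "x' = 4 * of_int n - x" and y': "y' = 4 * of_int n - 1 - y" using assms by auto
  have "qval x y eR = x * y - 2 + x' * y'"
    unfolding eR_def qval_def x' y' by (simp add: algebra_simps)
  also have "\<dots> = (x * x') * (y * y') * (x * y) - 2 * ((x * x') * (y * y')) + x' * y'"
    using assms by simp
  also have "\<dots> = (x * y - 1) * (x * y - 1) * (x' * y')" by (simp add: algebra_simps)
  finally show "qval x y eR = (x * y - 1) * (x * y - 1) * (x' * y')" .
  have "qval x y eR' = x * y' + x' * y - 2"
    unfolding eR'_def qval_def x' y' by (simp add: algebra_simps)
  also have "\<dots> = (y * y') * (x * y') + (x * x') * (x' * y) - 2 * ((x * x') * (y * y'))"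
    using assms by simp
  also have "\<dots> = (y' - x') * (y' - x') * (x * y)" by (simp add: algebra_simps)
  finally show "qval x y eR' = (y' - x') * (y' - x') * (x * y)" .
qed

lemma qval_eP: "qval x y eP = x" "qval x y eP' = 4 * of_int n - x"
  and qval_eQ: "qval x y eQ = y" "qval x y eQ' = 4 * of_int n - 1 - y"
  unfolding eP_def eP'_def eQ_def eQ'_def qval_def by simp_all

text \<open>Every conjugate of \<open>eR\<close> and of \<open>eR'\<close> is the square of a
  nonzero real times a product of two positive numbers, and the two elements are inverse to each
  other because U U' = 1.\<close>

lemma qunit_basic: "qunit eP" "qunit eP'" "qunit eQ" "qunit eQ'" "qunit eR" "qunit eR'"
proof -
  note pos = ord inverse_bounds
  have comm: "P' + P = 4 * of_int n" "P' * P = 1" "Q' + Q = 4 * of_int n - 1" "Q' * Q = 1"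
    using P Q by (simp_all add: add.commute mult.commute)
  have eqs: "4 * of_int n - P = P'" "4 * of_int n - P' = P" "4 * of_int n - 1 - Q = Q'" "4 * of_int n - 1 - Q' = Q"
    using P Q by auto
  have E: "qval P Q eP * P' = 1" "qval P Q eP' * P = 1" "qval P Q eQ * Q' = 1" "qval P Q eQ' * Q = 1"
    unfolding qval_eP qval_eQ eqs using P Q comm by simp_all
  have R: "((P * Q - 1) * (P * Q - 1) * (P' * Q')) * ((Q' - P') * (Q' - P') * (P * Q)) = 1"
  proof -
    have "((P * Q - 1) * (P * Q - 1) * (P' * Q')) * ((Q' - P') * (Q' - P') * (P * Q))
      = (U * U') * (U * U') * (P * P') * (Q * Q')"
      unfolding U_def U'_def by (simp only: mult_ac)
    then show ?thesis using UU' P Q by simp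
  qed
  have nz: "x * y - 1 \<noteq> 0 \<and> 0 < x * y" if "x \<in> {P, P'}" "y \<in> {Q, Q'}" for x y
    using that product_bounds pos by auto
  have nz': "y' - x' \<noteq> 0" if "x' \<in> {P, P'}" "y' \<in> {Q, Q'}" for x' y'
    using that pos by auto
  have sq: "0 < a * a" if "a \<noteq> 0" for a :: real using that zero_less_power2[of a] by (simp add: power2_eq_square)
  show "qunit eP" "qunit eP'" "qunit eQ" "qunit eQ'"
    unfolding qunit_def qpos_def using E PQ_E pos
    by (auto simp: qval_eP qval_eQ eqs)
  note Rs = qval_eR[OF P Q] qval_eR[OF comm(1,2) Q] qval_eR[OF P comm(3,4)] qval_eR[OF comm]
  have "0 < (x * y - 1) * (x * y - 1) * (x' * y')"
    if "x \<in> {P, P'}" "y \<in> {Q, Q'}" "0 < x'" "0 < y'" for x y x' y'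
    using nz[OF that(1,2)] that(3,4) by (intro mult_pos_pos[OF sq mult_pos_pos]) auto
  then have 1: "qpos eR" unfolding qpos_def Rs using pos by simp
  have "0 < (y' - x') * (y' - x') * (x * y)"
    if "x' \<in> {P, P'}" "y' \<in> {Q, Q'}" "0 < x" "0 < y" for x y x' y'
    using nz'[OF that(1,2)] that(3,4) by (intro mult_pos_pos[OF sq mult_pos_pos]) auto
  then have 2: "qpos eR'" unfolding qpos_def Rs using pos by simp
  show "qunit eR" "qunit eR'"
    unfolding qunit_def Rs
    by (rule conjI[OF 1 bexI], rule R, rule R_E)
      (rule conjI[OF 2 bexI], rule trans[OF mult.commute R], rule R_E)
qed

section \<open>Reduction to the cones over the two facets\<close>

lemma reduce_by_unit:
  assumes "qunit e" "qval P Q (qmul w e) \<in> gen"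
  shows "qval P Q w \<in> gen"
proof -
  obtain t where t: "t \<in> E" "qval P Q e * t = 1" using assms(1) unfolding qunit_def by blast
  have "t * qval P Q (qmul w e) = qval P Q w * (qval P Q e * t)"
    by (simp add: qval_qmul sq_P sq_Q)
  then show ?thesis using gen_mult[OF assms(2) t(1)] t(2) by simp
qed

text \<open>Each compared form exceeds \<open>M\<close> by 4n - 3 times a single coordinate, so
  minimality of \<open>M\<close> says precisely that all four coordinates are nonnegative.\<close>

lemma simplex_cone_points:
  assumes "M w \<le> L w" "M w \<le> L (qmul w eQ)" "M w \<le> L (qmul w eR)" "M w \<le> L (qmul w (qmul eQ eR))"
  shows "qval P Q w \<in> gen0"
proof -
  obtain a b c d where w: "w = (a, b, c, d)" by (cases w)
  have "L w - M w = (4 * n - 3) * b" "L (qmul w eQ) - M w = (4 * n - 3) * c"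
    "L (qmul w eR) - M w = (4 * n - 3) * a" "L (qmul w (qmul eQ eR)) - M w = (4 * n - 3) * d"
    unfolding w L_def M_def qmul_def eQ_def eR_def by (simp_all add: algebra_simps)
  then have "0 \<le> (4 * n - 3) * b" "0 \<le> (4 * n - 3) * c" "0 \<le> (4 * n - 3) * a" "0 \<le> (4 * n - 3) * d"
    using assms by linarith+
  then have nonneg: "0 \<le> b" "0 \<le> c" "0 \<le> a" "0 \<le> d" using n by (simp_all add: zero_le_mult_iff)
  have "of_int a * 1 + (of_int b * P + (of_int c * Q + of_int d * (P * Q))) \<in> gen0"
    by (intro gen0_add gen0_scale gen0_unit nonneg E1 E_mult PQ_E)
  then show ?thesis unfolding w qval_def by (simp add: algebra_simps)
qed

text \<open>The coordinates come from writing the element as A + B Q + (x + y Q) U: \<open>L\<close>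
  is 1 at 1 and Q and 0 at U and QU, so A + B is its value. Each of the twelve comparisons is then
  one inequality of the cone. Those of \<open>L\<close> at the multiples by Q and Q' give B \<ge> 0
  and A \<ge> 0, that is, the two hexagons; the other ten belong to the side faces.\<close>

lemma facet_cone_reduced_points:
  assumes LL: "\<And>e. e \<in> {eP, eP', eQ, eQ', qmul eP eQ, qmul eP' eQ', qmul eP eQ', qmul eP' eQ} \<Longrightarrow> L w \<le> L (qmul w e)"
    and LM: "L w \<le> M w" "\<And>e. e \<in> {eQ', qmul eQ' eR', eR'} \<Longrightarrow> L w \<le> M (qmul w e)"
  shows "qval P Q w \<in> gen0"
proof -
  obtain a b c d where w: "w = (a, b, c, d)" by (cases w)
  define m where m: "m = 4 * n - 2"
  define y where "y = - b"
  define B where "B = c + y"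
  define x where "x = d - (m + 1) * y"
  define A where "A = a + x"
  have w: "w = (A - x, - y, B - y, x + (m + 1) * y)"
    unfolding w A_def B_def x_def y_def by simp
  have n4: "4 * n = m + 2" using m by simp
  have pos: "0 < m - 1" using m n by simp
  note defs = w L_def M_def qmul_def eP_def eP'_def eQ_def eQ'_def eR'_def n4
  have Ls: "L (qmul w eP) - L w = (m - 1) * A + x + y" "L (qmul w eP') - L w = A + m * B - x - y"
    "L (qmul w eQ) - L w = (m - 1) * B" "L (qmul w eQ') - L w = (m - 1) * A"
    "L (qmul w (qmul eP eQ)) - L w = x + m * y"
    "L (qmul w (qmul eP' eQ')) - L w = m * A + B - m * x - y"
    "L (qmul w (qmul eP eQ')) - L w = (m * m + m - 2) * A + (m - 1) * B + m * x + y"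
    "L (qmul w (qmul eP' eQ)) - L w = m * A + (m * m + 2 * m - 2) * B - x - m * y"
    unfolding defs by (simp_all add: algebra_simps)
  have Ms: "M w - L w = (m - 1) * y" "M (qmul w eQ') - L w = (m - 1) * (A - x)"
    "M (qmul w (qmul eQ' eR')) - L w = (m - 1) * ((m + 1) * A + 2 * B + x)"
    "M (qmul w eR') - L w = (m - 1) * (2 * A + (m + 2) * B - y)"
    unfolding defs by (simp_all add: algebra_simps)
  have "0 \<le> (m - 1) * B" "0 \<le> (m - 1) * A" "0 \<le> (m - 1) * y" "0 \<le> (m - 1) * (A - x)"
    "0 \<le> (m - 1) * ((m + 1) * A + 2 * B + x)" "0 \<le> (m - 1) * (2 * A + (m + 2) * B - y)"
    unfolding Ls[symmetric] Ms[symmetric] using LL LM by simp_all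
  then have 1: "0 \<le> B" "0 \<le> A" "0 \<le> y" "0 \<le> A - x" "0 \<le> (m + 1) * A + 2 * B + x" "0 \<le> 2 * A + (m + 2) * B - y"
    using pos by (simp_all add: zero_le_mult_iff)
  have LL': "0 \<le> L (qmul w e) - L w"
    if "e \<in> {eP, eP', eQ, eQ', qmul eP eQ, qmul eP' eQ', qmul eP eQ', qmul eP' eQ}" for e
    using LL[OF that] by simp
  have 2: "0 \<le> (m - 1) * A + x + y" "0 \<le> A + m * B - x - y" "0 \<le> x + m * y"
    "0 \<le> m * A + B - m * x - y" "0 \<le> (m * m + m - 2) * A + (m - 1) * B + m * x + y"
    "0 \<le> m * A + (m * m + 2 * m - 2) * B - x - m * y"
    using LL'[of eP] LL'[of eP'] LL'[of "qmul eP eQ"] LL'[of "qmul eP' eQ'"]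
      LL'[of "qmul eP eQ'"] LL'[of "qmul eP' eQ"] unfolding Ls by simp_all
  have "of_int A + of_int B * Q + (of_int x + of_int y * Q) * U \<in> gen0"
    by (rule facet_cone_points[OF m]) (use 1 2 in simp_all)
  also have "of_int A + of_int B * Q + (of_int x + of_int y * Q) * U =
      of_int A + of_int B * Q + of_int x * U + of_int y * (P * (Q * Q) - Q)"
    unfolding U_def by (simp add: algebra_simps)
  also have "\<dots> = qval P Q w"
    unfolding w qval_def sq_Q U_def m by (simp add: algebra_simps)
  finally show ?thesis .
qed

lemma qpos_in_gen: "qpos w \<Longrightarrow> qval P Q w \<in> gen"
proof (induction "nat (min (L w) (M w))" arbitrary: w rule: less_induct)
  case less
  show ?case
  proof (cases "\<exists>e. qunit e \<and> min (L (qmul w e)) (M (qmul w e)) < min (L w) (M w)")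
    case True
    then obtain e where e: "qunit e" "min (L (qmul w e)) (M (qmul w e)) < min (L w) (M w)" by blast
    have "qpos (qmul w e)" using less.prems e(1) qpos_qmul unfolding qunit_def by blast
    then have "qval P Q (qmul w e) \<in> gen"
      using less.hyps[of "qmul w e"] e(2) L_pos M_pos less.prems by simp
    then show ?thesis using reduce_by_unit e(1) by blast
  next
    case False
    then have min: "min (L w) (M w) \<le> L (qmul w e)" "min (L w) (M w) \<le> M (qmul w e)" if "qunit e" for e
      using that by (metis not_le min_less_iff_disj)+
    have "qval P Q w \<in> gen0"
    proof (cases "M w \<le> L w")
      case True
      then have "M w \<le> L (qmul w e)" if "qunit e" for e
        using min(1)[OF that] by (simp only: min_absorb2)
      then show ?thesis
        using True qunit_basic qunit_qmul by (intro simplex_cone_points) simp_all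
    next
      case False
      then have LM: "L w \<le> L (qmul w e)" "L w \<le> M (qmul w e)" if "qunit e" for e
        using min[OF that] by simp_all
      show ?thesis
      proof (rule facet_cone_reduced_points)
        show "L w \<le> M w" using False by simp
        show "L w \<le> L (qmul w e)"
          if "e \<in> {eP, eP', eQ, eQ', qmul eP eQ, qmul eP' eQ', qmul eP eQ', qmul eP' eQ}" for e
          using that qunit_basic qunit_qmul by (intro LM) blast
        show "L w \<le> M (qmul w e)" if "e \<in> {eQ', qmul eQ' eR', eR'}" for e
          using that qunit_basic qunit_qmul by (intro LM) blast
      qed
    qed
    moreover have "qval P Q w \<noteq> 0" using less.prems unfolding qpos_def by simp
    ultimately show ?thesis unfolding gen0_def by simp
  qed
qed

section \<open>The candidates as points of the facet \<open>L\<close> = 1\<close>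

definition cone_quad :: "int \<Rightarrow> quad" where
  "cone_quad k = (4 * n - k, -1, -1, k)"

lemma qval_cone_quad:
  assumes "x + x' = 4 * of_int n" "x * x' = 1"
  shows "qval x y (cone_quad k) = (x * y - 1) * (of_int k - x')"
proof -
  have "(x * y - 1) * (of_int k - x') = of_int k * x * y - (x * x') * y - of_int k + x'"
    by (simp add: algebra_simps)
  moreover have "x' = 4 * of_int n - x" using assms by simp
  ultimately show ?thesis using assms(2) unfolding cone_quad_def qval_def by simp
qed

lemma qval_cone_quad': "qval P Q (cone_quad k) = U * (of_int k - P')"
  unfolding U_def by (rule qval_cone_quad[OF P])

text \<open>At P both factors of the conjugate are positive. At P' both are negative: P' Q and P' Q'
  are below 1, and k is below P.\<close>

lemma qpos_cone_quad:
  assumes "1 \<le> k" "k \<le> 4 * n - 2"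
  shows "qpos (cone_quad k)"
proof -
  note pos = ord inverse_bounds
  have comm: "P' + P = 4 * of_int n" "P' * P = 1"
    using P by (simp_all add: add.commute mult.commute)
  have "P' < of_int k" "of_int k < P"
    using assms pos P(1) by linarith+
  then show ?thesis
    unfolding qpos_def qval_cone_quad[OF P] qval_cone_quad[OF comm]
    using product_bounds by (auto intro: mult_neg_neg)
qed

lemma L_cone_quad: "L (cone_quad k) = 1"
  unfolding L_def cone_quad_def by simp

lemma L_add: "L (a + e, b + f, c + g, d + h) = L (a, b, c, d) + L (e, f, g, h)"
  unfolding L_def by (simp add: algebra_simps)

end

section \<open>The biquadratic field\<close>

locale biquadratic_family =
  fixes n p q :: int
  assumes n: "n \<ge> 2"
    and p: "p = (2 * n - 1) * (2 * n + 1)"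
    and q: "q = (4 * n - 3) * (4 * n + 1)"
    and coprime: "coprime p q" and sqfree: "squarefree p" "squarefree q"
begin

definition s where "s = sqrt (of_int p)"
definition t where "t = sqrt (of_int q)"
definition P where "P = 2 * of_int n + s"
definition P' where "P' = 2 * of_int n - s"
definition Q where "Q = (4 * of_int n - 1 + t) / 2"
definition Q' where "Q' = (4 * of_int n - 1 - t) / 2"
definition F where "F = adjoin_sqrt \<rat> s"
definition K where "K = adjoin_sqrt F t"

lemma p_eq: "p = (2 * n) ^ 2 - 1" and q_eq: "q = (4 * n - 1) ^ 2 - 4"
  unfolding p q by (simp_all add: power2_eq_square algebra_simps)

lemma p_real: "real_of_int p = (2 * of_int n) ^ 2 - 1" and q_real: "real_of_int q = (4 * of_int n - 1) ^ 2 - 4"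
  unfolding p_eq q_eq by simp_all

lemma p_mod: "p mod 4 = 3"
proof -
  have "p = 4 * (n ^ 2 - 1) + 3" unfolding p_eq by (simp add: power2_eq_square)
  then show ?thesis by presburger
qed

lemma q_mod: "q mod 4 = 1"
proof -
  have "q = 4 * (4 * n ^ 2 - 2 * n - 1) + 1" unfolding q_eq by (simp add: power2_eq_square algebra_simps)
  then show ?thesis by presburger
qed

lemma s_bounds: "2 * of_int n - 1 < s" "s < 2 * of_int n"
proof -
  have "(2 * real_of_int n - 1) ^ 2 < of_int p" "real_of_int p < (2 * of_int n) ^ 2"
    using n unfolding p_real by (simp_all add: power2_eq_square algebra_simps)
  then show "2 * of_int n - 1 < s" "s < 2 * of_int n"
    using n unfolding s_def by (simp_all add: real_less_rsqrt real_less_lsqrt)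
qed

lemma t_bounds: "4 * of_int n - 2 < t" "t < 4 * of_int n - 1"
proof -
  have "(4 * real_of_int n - 2) ^ 2 < of_int q" "real_of_int q < (4 * of_int n - 1) ^ 2"
    using n unfolding q_real by (simp_all add: power2_eq_square algebra_simps)
  then show "4 * of_int n - 2 < t" "t < 4 * of_int n - 1"
    using n unfolding t_def by (simp_all add: real_less_rsqrt real_less_lsqrt)
qed

lemma p_gt_1: "p > 1" and q_gt_1: "q > 1"
  using n mult_strict_mono[of 1 "2 * n - 1" 1 "2 * n + 1"] mult_strict_mono[of 1 "4 * n - 3" 1 "4 * n + 1"]
  unfolding p q by auto

lemma ss: "s * s = of_int p" and tt: "t * t = of_int q"
  using p_gt_1 q_gt_1 by (simp_all add: s_def t_def)

lemma st: "s * t = sqrt (of_int (p * q))"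
  by (simp add: s_def t_def real_sqrt_mult)

lemma PP': "P + P' = 4 * of_int n" "P * P' = 1"
proof -
  have "P * P' = (2 * of_int n) ^ 2 - s * s"
    unfolding P_def P'_def by (simp add: power2_eq_square algebra_simps)
  then show "P * P' = 1" unfolding ss p_real by simp
qed (simp add: P_def P'_def)

lemma QQ': "Q + Q' = 4 * of_int n - 1" "Q * Q' = 1"
proof -
  have "Q * Q' = ((4 * of_int n - 1) ^ 2 - t * t) / 4"
    unfolding Q_def Q'_def by (simp add: power2_eq_square algebra_simps)
  then show "Q * Q' = 1" unfolding tt q_real by simp
qed (simp add: Q_def Q'_def field_simps)

lemma PQ_order: "1 < Q" "Q < P" "4 * of_int n - 1 < P"
  using s_bounds t_bounds n unfolding P_def Q_def by simp_all

lemma sqfree_pq: "squarefree (p * q)"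
  using squarefree_mult_coprime[OF coprime sqfree] .

lemma pq_gt_1: "p * q > 1"
  using mult_strict_mono[of 1 p 1 q] p_gt_1 q_gt_1 by simp

lemma irrational: "s \<notin> \<rat>" "t \<notin> \<rat>" "s * t \<notin> \<rat>"
  using sqrt_squarefree_irrational sqfree p_gt_1 q_gt_1 sqfree_pq pq_gt_1
  unfolding st unfolding s_def t_def by blast+

lemma subfield_F: "real_subfield F"
  unfolding F_def by (rule real_subfield_adjoin_sqrt[OF real_subfield_Rats]) (simp add: ss)

lemma Rats_F: "x \<in> \<rat> \<Longrightarrow> x \<in> F"
  using real_subfield_Rats_subset[OF subfield_F] by blast

text \<open>Squaring t = a + b s gives a b = 0, so either t or s t would be rational.\<close>

lemma t_notin_F: "t \<notin> F"
proof
  assume "t \<in> F"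
  then obtain a b where ab: "a \<in> \<rat>" "b \<in> \<rat>" "t = a + b * s" unfolding F_def by (rule adjoin_sqrtE)
  have "of_int q = (a * a + b * b * of_int p) + (2 * a * b) * s"
    unfolding tt[symmetric] ss[symmetric] ab(3) by (simp add: algebra_simps)
  then have "of_int q + 0 * s = (a * a + b * b * of_int p) + (2 * a * b) * s" by simp
  from adjoin_sqrt_unique[OF real_subfield_Rats irrational(1) _ _ _ _ this] have "2 * a * b = 0"
    using ab(1,2) by simp
  then consider "a = 0" | "b = 0" by auto
  then show False
  proof cases
    case 1
    then have "s * t = b * of_int p" using ab(3) ss by (simp add: algebra_simps)
    then show ?thesis using irrational(3) ab(2) by simp
  next
    case 2
    then show ?thesis using ab irrational(2) by simp
  qed
qed

lemma tt_F: "t * t \<in> F"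
  by (simp add: tt Rats_F)

lemma subfield_K: "real_subfield K"
  unfolding K_def by (rule real_subfield_adjoin_sqrt[OF subfield_F tt_F])

lemma F_subset_K: "x \<in> F \<Longrightarrow> x \<in> K"
  unfolding K_def using real_subfieldD(1)[OF subfield_F] by (intro adjoin_sqrt_cong[of _ x 0]) auto

lemma K_eq: "K = rat_adjoin {sqrt (of_int p), sqrt (of_int q)}" and F_eq: "F = rat_adjoin {sqrt (of_int p)}"
proof -
  show F: "F = rat_adjoin {sqrt (of_int p)}"
    unfolding F_def s_def using rat_adjoin_sqrt p_gt_1 by simp
  have "rat_adjoin {t, s} = adjoin_sqrt (rat_adjoin {s}) t"
    by (rule rat_adjoin_insert) (use tt_F F in \<open>simp add: s_def\<close>)
  then show "K = rat_adjoin {sqrt (of_int p), sqrt (of_int q)}"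
    unfolding K_def F s_def[symmetric] t_def[symmetric] by (simp add: insert_commute)
qed

lemma K_coordinates:
  assumes "x \<in> K"
  obtains a b c d where "a \<in> \<rat>" "b \<in> \<rat>" "c \<in> \<rat>" "d \<in> \<rat>" "x = (a + b * s) + (c + d * s) * t"
  using assms unfolding K_def F_def by (metis adjoin_sqrtE)

lemma conjugation:
  assumes "s' \<in> {s, - s}" "t' \<in> {t, - t}"
  obtains \<sigma> where "real_embedding K \<sigma>"
    "\<And>a b c d. a \<in> \<rat> \<Longrightarrow> b \<in> \<rat> \<Longrightarrow> c \<in> \<rat> \<Longrightarrow> d \<in> \<rat> \<Longrightarrow>
       \<sigma> ((a + b * s) + (c + d * s) * t) = (a + b * s') + (c + d * s') * t'"
proof -
  have s': "s' * s' = s * s" and t': "t' * t' = t * t" using assms by auto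
  obtain \<tau> where \<tau>: "real_embedding F \<tau>" "\<And>a b. a \<in> \<rat> \<Longrightarrow> b \<in> \<rat> \<Longrightarrow> \<tau> (a + b * s) = a + b * s'"
    using real_embedding_adjoin_sqrt[OF real_subfield_Rats irrational(1) _ real_embedding_id s'] ss
    unfolding F_def by auto
  have "t' * t' = \<tau> (t * t)"
    unfolding t' tt using real_embedding_of_int[OF \<tau>(1) subfield_F] by simp
  then obtain \<sigma> where \<sigma>: "real_embedding K \<sigma>"
    "\<And>a b. a \<in> F \<Longrightarrow> b \<in> F \<Longrightarrow> \<sigma> (a + b * t) = \<tau> a + \<tau> b * t'"
    using real_embedding_adjoin_sqrt[OF subfield_F t_notin_F tt_F \<tau>(1)] unfolding K_def by blast
  show ?thesis
    by (rule that[OF \<sigma>(1)]) (simp add: \<sigma>(2) \<tau>(2) F_def adjoin_sqrtI)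
qed

lemma coordinates_unique:
  assumes "a \<in> \<rat>" "b \<in> \<rat>" "c \<in> \<rat>" "d \<in> \<rat>" "a' \<in> \<rat>" "b' \<in> \<rat>" "c' \<in> \<rat>" "d' \<in> \<rat>"
    and "(a + b * s) + (c + d * s) * t = (a' + b' * s) + (c' + d' * s) * t"
  shows "a = a' \<and> b = b' \<and> c = c' \<and> d = d'"
proof -
  have "a + b * s = a' + b' * s \<and> c + d * s = c' + d' * s"
    by (rule adjoin_sqrt_unique[OF subfield_F t_notin_F]) (use assms in \<open>auto simp: F_def intro: adjoin_sqrtI\<close>)
  then show ?thesis
    using adjoin_sqrt_unique[OF real_subfield_Rats irrational(1)] assms by metis
qed

section \<open>The integral basis 1, P, Q, PQ\<close>

lemma algebraic_int_P: "algebraic_int P"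
  unfolding P_def s_def by (intro algebraic_int_add_mult(1) algebraic_int_sqrt int_imp_algebraic_int) auto

lemma algebraic_int_Q: "algebraic_int Q"
proof (rule algebraic_int.intros)
  let ?f = "[:1, - (4 * of_int n - 1), 1:] :: real poly"
  show "lead_coeff ?f = 1" by simp
  show "\<forall>i. coeff ?f i \<in> \<int>" by (auto simp: coeff_pCons split: nat.splits)
  have "Q * Q = Q * (Q + Q') - Q * Q'" by (simp add: algebra_simps)
  then show "poly ?f Q = 0" unfolding QQ' by (simp add: algebra_simps)
qed

lemma PQ_K: "P \<in> F" "P \<in> K" "Q \<in> K"
proof -
  show P: "P \<in> F" unfolding P_def F_def by (intro adjoin_sqrt_cong[of _ "2 * of_int n" 1]) auto
  then show "P \<in> K" by (rule F_subset_K)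
  have "Q = (4 * of_int n - 1) / 2 + (1 / 2) * t" unfolding Q_def by (simp add: field_simps)
  then show "Q \<in> K" unfolding K_def by (rule adjoin_sqrt_cong) (auto intro!: Rats_F)
qed

lemma qval_P_Q_integer: "qval P Q w \<in> ring_of_integers K"
proof -
  obtain a b c d where w: "w = (a, b, c, d)" by (cases w)
  note D = real_subfieldD[OF subfield_K] and I = real_subfield_of_int[OF subfield_K]
  have "qval P Q w \<in> K"
    unfolding w qval_def split by (intro D I PQ_K)
  moreover have "algebraic_int (qval P Q w)"
    unfolding w qval_def split
    by (intro algebraic_int_add_mult algebraic_int_P algebraic_int_Q int_imp_algebraic_int Ints_of_int)
  ultimately show ?thesis unfolding ring_of_integers_def by simp
qed

text \<open>Substitute s = P - 2n and t = 2Q - (4n - 1). The parity conditions are exactly what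
  clears the remaining halves.\<close>

lemma qval_coordinates:
  fixes a b c d :: int
  assumes "even a \<longleftrightarrow> even c" "even b \<longleftrightarrow> even d"
    and x: "x = (of_int a / 2 + of_int b / 2 * s) + (of_int c / 2 + of_int d / 2 * s) * t"
  obtains w where "x = qval P Q w"
proof -
  have "even (a - (4 * n - 1) * c)" "even (b - (4 * n - 1) * d)" using assms(1,2) by auto
  then obtain e f where ef: "a - (4 * n - 1) * c = 2 * e" "b - (4 * n - 1) * d = 2 * f" by (meson evenE)
  have "a = 2 * e + (4 * n - 1) * c" "b = 2 * f + (4 * n - 1) * d" using ef by auto
  then have ab: "real_of_int a = 2 * of_int e + (4 * of_int n - 1) * of_int c"
    "real_of_int b = 2 * of_int f + (4 * of_int n - 1) * of_int d" by auto
  have "x = qval P Q (e - 2 * n * f, f, c - 2 * n * d, d)"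
    unfolding x qval_def P_def Q_def ab by (simp add: field_simps)
  then show ?thesis by (rule that)
qed

text \<open>Adding x to one of its other conjugates gives integers 2a + 2b \<surd>p, 2a + 2c
  \<surd>q and 2a + 2d \<surd>(pq) of the three quadratic subfields. As p and pq are 3 modulo 4 and
  q is odd, all of 2a, 2b, 2c, 2d are integers. The parity conditions among them need one more
  invariant, the relative norm over F.\<close>

lemma integer_coordinates:
  assumes "x \<in> ring_of_integers K"
  obtains a b c d :: int where "even a \<longleftrightarrow> even c" "even b \<longleftrightarrow> even d"
    "x = (of_int a / 2 + of_int b / 2 * s) + (of_int c / 2 + of_int d / 2 * s) * t"
proof -
  have x: "x \<in> K" "algebraic_int x" using assms by (auto simp: ring_of_integers_def)
  obtain a b c d where abcd: "a \<in> \<rat>" "b \<in> \<rat>" "c \<in> \<rat>" "d \<in> \<rat>" "x = (a + b * s) + (c + d * s) * t"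
    using K_coordinates[OF x(1)] .
  have alg: "algebraic_int ((a + b * s') + (c + d * s') * t')" if st': "s' \<in> {s, - s}" "t' \<in> {t, - t}" for s' t'
  proof -
    obtain \<sigma> where "real_embedding K \<sigma>" "\<sigma> x = (a + b * s') + (c + d * s') * t'"
      using conjugation[OF st'] abcd by metis
    then show ?thesis using algebraic_int_real_embedding[OF subfield_K _ x] by metis
  qed
  have "algebraic_int (((a + b * s) + (c + d * s) * t) + ((a + b * s) + (c + d * s) * (- t)))"
    by (intro algebraic_int_add_mult(1) alg) auto
  then have "algebraic_int (2 * a + 2 * b * sqrt (of_int p))" by (simp add: s_def algebra_simps)
  then obtain A1 B1 where 1: "2 * (2 * a) = of_int A1" "2 * (2 * b) = of_int B1" "4 dvd A1 ^ 2 - p * B1 ^ 2"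
    using algebraic_int_rat_sqrt[OF sqfree(1) p_gt_1, of "2 * a" "2 * b"] abcd by auto
  then have "even A1" "even B1" using parity_3_mod_4[OF 1(3) p_mod] by auto
  then obtain A B where A: "A1 = 2 * A" and B: "B1 = 2 * B" by (meson evenE)
  have "algebraic_int (((a + b * s) + (c + d * s) * t) + ((a + b * (- s)) + (c + d * (- s)) * t))"
    by (intro algebraic_int_add_mult(1) alg) auto
  then have "algebraic_int (2 * a + 2 * c * sqrt (of_int q))" by (simp add: t_def algebra_simps)
  then obtain A2 C1 where 2: "2 * (2 * a) = of_int A2" "2 * (2 * c) = of_int C1" "4 dvd A2 ^ 2 - q * C1 ^ 2"
    using algebraic_int_rat_sqrt[OF sqfree(2) q_gt_1, of "2 * a" "2 * c"] abcd by auto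
  have "odd q" using q_mod by presburger
  moreover have "A2 = A1" using 1 2 by simp
  ultimately have "even C1" using parity_1_mod_4[OF 2(3)] \<open>even A1\<close> by simp
  then obtain C where C: "C1 = 2 * C" by (auto elim!: evenE)
  have "algebraic_int (((a + b * s) + (c + d * s) * t) + ((a + b * (- s)) + (c + d * (- s)) * (- t)))"
    by (intro algebraic_int_add_mult(1) alg) auto
  then have "algebraic_int (2 * a + 2 * d * (s * t))" by (simp add: algebra_simps)
  then obtain A3 D1 where 3: "2 * (2 * a) = of_int A3" "2 * (2 * d) = of_int D1" "4 dvd A3 ^ 2 - p * q * D1 ^ 2"
    using algebraic_int_rat_sqrt[OF sqfree_pq pq_gt_1, of "2 * a" "2 * d"] abcd unfolding st by auto
  have "p * q mod 4 = (p mod 4) * (q mod 4) mod 4" by (simp add: mod_mult_eq)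
  then have "p * q mod 4 = 3" by (simp add: p_mod q_mod)
  then have "even D1" using parity_3_mod_4[OF 3(3)] by auto
  then obtain D where D: "D1 = 2 * D" by (auto elim!: evenE)
  have half: "a = of_int A / 2" "b = of_int B / 2" "c = of_int C / 2" "d = of_int D / 2"
    using 1 2 3 unfolding A B C D by auto
  \<comment> \<open>X + Y \<surd>p is the product of x with its conjugate under t \<mapsto> -t. Both
    X and Y are integers because p is 3 modulo 4; reducing with p = -1 and q = 1 modulo 4 gives the
    two congruences.\<close>
  define X where "X = a\<^sup>2 + of_int p * b\<^sup>2 - of_int q * (c\<^sup>2 + of_int p * d\<^sup>2)"
  define Y where "Y = 2 * a * b - of_int q * (2 * c * d)"
  have "algebraic_int (((a + b * s) + (c + d * s) * t) * ((a + b * s) + (c + d * s) * (- t)))"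
    by (intro algebraic_int_add_mult(2) alg) auto
  also have "((a + b * s) + (c + d * s) * t) * ((a + b * s) + (c + d * s) * (- t))
     = (a\<^sup>2 + (s * s) * b\<^sup>2 - (t * t) * (c\<^sup>2 + (s * s) * d\<^sup>2)) + (2 * a * b - (t * t) * (2 * c * d)) * s"
    by (simp add: algebra_simps power2_eq_square)
  also have "\<dots> = X + Y * sqrt (of_int p)" unfolding ss tt X_def Y_def by (simp add: s_def)
  finally have XY: "algebraic_int (X + Y * sqrt (of_int p))" .
  have "X \<in> \<rat>" "Y \<in> \<rat>" unfolding X_def Y_def using abcd by auto
  then obtain X1 Y1 where 4: "2 * X = of_int X1" "2 * Y = of_int Y1" "4 dvd X1 ^ 2 - p * Y1 ^ 2"
    using algebraic_int_rat_sqrt[OF sqfree(1) p_gt_1 _ _ XY] by auto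
  then have "even X1" "even Y1" using parity_3_mod_4[OF 4(3) p_mod] by auto
  then obtain X' Y' where X': "X1 = 2 * X'" and Y': "Y1 = 2 * Y'" by (meson evenE)
  have "real_of_int (A\<^sup>2 + p * B\<^sup>2 - q * (C\<^sup>2 + p * D\<^sup>2)) = of_int (4 * X')"
    using 4(1) unfolding X_def X' half by (simp add: power2_eq_square field_simps)
  then have eqX: "A\<^sup>2 + p * B\<^sup>2 - q * (C\<^sup>2 + p * D\<^sup>2) = 4 * X'" using of_int_eq_iff by blast
  have "real_of_int (A * B - q * (C * D)) = of_int (2 * Y')"
    using 4(2) unfolding Y_def Y' half by (simp add: field_simps)
  then have eqY: "A * B - q * (C * D) = 2 * Y'" using of_int_eq_iff by blast
  obtain e where e: "p = 4 * e + 3" using p_mod by (metis mult_div_mod_eq)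
  obtain f where f: "q = 4 * f + 1" using q_mod by (metis mult_div_mod_eq)
  have "A\<^sup>2 - B\<^sup>2 - C\<^sup>2 + D\<^sup>2 = 4 * (X' - (e + 1) * B\<^sup>2 + f * C\<^sup>2 + (4 * e * f + 3 * f + e + 1) * D\<^sup>2)"
    using eqX unfolding e f by (simp add: algebra_simps)
  then have "4 dvd A\<^sup>2 - B\<^sup>2 - C\<^sup>2 + D\<^sup>2" by simp
  moreover have "A * B - C * D = 2 * (Y' + 2 * f * (C * D))" using eqY unfolding f by (simp add: algebra_simps)
  then have "even (A * B - C * D)" by simp
  ultimately have "(even A \<longleftrightarrow> even C) \<and> (even B \<longleftrightarrow> even D)" by (rule parity_biquadratic)
  then show ?thesis using that[of A C B D] abcd(5) unfolding half by blast
qed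

lemma ring_of_integers_K: "ring_of_integers K = range (qval P Q)"
proof
  show "ring_of_integers K \<subseteq> range (qval P Q)"
    by (metis integer_coordinates qval_coordinates rangeI subsetI)
qed (auto simp: qval_P_Q_integer)

section \<open>Embeddings, total positivity and units of \<open>K\<close>\<close>

lemma embedding_values:
  assumes \<sigma>: "real_embedding K \<sigma>"
  shows "\<sigma> P \<in> {P, P'}" "\<sigma> Q \<in> {Q, Q'}" "\<sigma> (qval P Q w) = qval (\<sigma> P) (\<sigma> Q) w"
proof -
  note D = real_subfieldD[OF subfield_K] and I = real_subfield_of_int[OF subfield_K]
  note H = real_embeddingD[OF \<sigma> subfield_K] and HI = real_embedding_of_int[OF \<sigma> subfield_K]
  have P': "P' = of_int (4 * n) - P" and Q': "Q' = of_int (4 * n - 1) - Q" using PP' QQ' by auto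
  have "\<sigma> (P * P') = \<sigma> P * \<sigma> P'" "\<sigma> P' = of_int (4 * n) - \<sigma> P"
    unfolding P' by (simp_all only: H PQ_K D I HI)
  then have "\<sigma> P * (of_int (4 * n) - \<sigma> P) = 1" using PP'(2) H(1) by simp
  moreover have "(\<sigma> P - P) * (\<sigma> P - P') = P * P' - \<sigma> P * (P + P' - \<sigma> P)" by (simp add: algebra_simps)
  ultimately have "(\<sigma> P - P) * (\<sigma> P - P') = 0" using PP' by simp
  then show "\<sigma> P \<in> {P, P'}" by auto
  have "\<sigma> (Q * Q') = \<sigma> Q * \<sigma> Q'" "\<sigma> Q' = of_int (4 * n - 1) - \<sigma> Q"
    unfolding Q' by (simp_all only: H PQ_K D I HI)
  then have "\<sigma> Q * (of_int (4 * n - 1) - \<sigma> Q) = 1" using QQ'(2) H(1) by simp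
  moreover have "(\<sigma> Q - Q) * (\<sigma> Q - Q') = Q * Q' - \<sigma> Q * (Q + Q' - \<sigma> Q)" by (simp add: algebra_simps)
  ultimately have "(\<sigma> Q - Q) * (\<sigma> Q - Q') = 0" using QQ' by simp
  then show "\<sigma> Q \<in> {Q, Q'}" by auto
  obtain a b c d where w: "w = (a, b, c, d)" by (cases w)
  show "\<sigma> (qval P Q w) = qval (\<sigma> P) (\<sigma> Q) w"
    unfolding w qval_def split by (simp only: H D I HI PQ_K)
qed

lemma embedding_exists:
  assumes "x \<in> {P, P'}" "y \<in> {Q, Q'}"
  obtains \<sigma> where "real_embedding K \<sigma>" "\<sigma> P = x" "\<sigma> Q = y"
proof -
  define s' where "s' = (if x = P then s else - s)"
  define t' where "t' = (if y = Q then t else - t)"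
  have "s' \<in> {s, - s}" "t' \<in> {t, - t}" by (auto simp: s'_def t'_def)
  then obtain \<sigma> where \<sigma>: "real_embedding K \<sigma>"
    "\<And>a b c d. a \<in> \<rat> \<Longrightarrow> b \<in> \<rat> \<Longrightarrow> c \<in> \<rat> \<Longrightarrow> d \<in> \<rat> \<Longrightarrow>
       \<sigma> ((a + b * s) + (c + d * s) * t) = (a + b * s') + (c + d * s') * t'"
    using conjugation by blast
  have "\<sigma> P = x"
    using \<sigma>(2)[of "2 * of_int n" 1 0 0] assms(1) by (auto simp: P_def P'_def s'_def)
  moreover
  have "Q = ((4 * of_int n - 1) / 2 + 0 * s) + (1 / 2 + 0 * s) * t" by (simp add: Q_def field_simps)
  then have Q_val: "\<sigma> Q = (4 * of_int n - 1) / 2 + 1 / 2 * t'"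
    using \<sigma>(2)[of "(4 * of_int n - 1) / 2" 0 "1 / 2" 0] by simp
  have "(4 * of_int n - 1) / 2 + 1 / 2 * t' = y"
    using assms(2) unfolding t'_def by (cases "y = Q") (auto simp: Q_def Q'_def field_simps)
  with Q_val have "\<sigma> Q = y" by simp
  ultimately show ?thesis using that \<sigma>(1) by blast
qed

lemma totally_positive_iff:
  "qval P Q w \<in> totally_positive_integers K \<longleftrightarrow>
     0 < qval P Q w \<and> 0 < qval P' Q w \<and> 0 < qval P Q' w \<and> 0 < qval P' Q' w"
proof
  assume pos: "qval P Q w \<in> totally_positive_integers K"
  have "0 < qval x y w" if xy: "x \<in> {P, P'}" "y \<in> {Q, Q'}" for x y
  proof -
    obtain \<sigma> where \<sigma>: "real_embedding K \<sigma>" "\<sigma> P = x" "\<sigma> Q = y" using embedding_exists[OF xy] .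
    then have "0 < \<sigma> (qval P Q w)" using pos unfolding totally_positive_integers_def by blast
    then show ?thesis using embedding_values(3)[OF \<sigma>(1), of w] \<sigma>(2,3) by simp
  qed
  then show "0 < qval P Q w \<and> 0 < qval P' Q w \<and> 0 < qval P Q' w \<and> 0 < qval P' Q' w" by blast
next
  assume pos: "0 < qval P Q w \<and> 0 < qval P' Q w \<and> 0 < qval P Q' w \<and> 0 < qval P' Q' w"
  have "\<sigma> (qval P Q w) > 0" if "real_embedding K \<sigma>" for \<sigma>
    using embedding_values[OF that] pos by auto
  then show "qval P Q w \<in> totally_positive_integers K"
    unfolding totally_positive_integers_def using qval_P_Q_integer by blast
qed

lemma integer_unitI: "qval P Q v * qval P Q w = 1 \<Longrightarrow> qval P Q v \<in> integer_units K"
  unfolding integer_units_def using qval_P_Q_integer by blast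

sublocale biquadratic_units n P P' Q Q' "totally_positive_units K"
proof
  show "n \<ge> 2" by (rule n)
  show "P + P' = 4 * of_int n" "P * P' = 1" "Q + Q' = 4 * of_int n - 1" "Q * Q' = 1"
    by (rule PP' QQ')+
  show ord: "1 < Q" "Q < P" by (rule PQ_order)+
  show "1 \<in> totally_positive_units K" by (rule one_totally_positive_unit[OF subfield_K])
  show mult: "x * y \<in> totally_positive_units K"
    if "x \<in> totally_positive_units K" "y \<in> totally_positive_units K" for x y
    by (rule totally_positive_units_mult[OF subfield_K that])
  have val: "P = qval P Q (0, 1, 0, 0)" "P' = qval P Q (4 * n, -1, 0, 0)"
    "Q = qval P Q (0, 0, 1, 0)" "Q' = qval P Q (4 * n - 1, 0, -1, 0)"
    "P * Q - 1 = qval P Q (-1, 0, 0, 1)" "Q' - P' = qval P Q (-1, 1, -1, 0)"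
    unfolding qval_def using PP' QQ' by simp_all
  have pos: "0 < P'" "0 < Q'" using PP' QQ' ord zero_less_mult_pos[of P P'] zero_less_mult_pos[of Q Q'] by auto
  have tp: "qval P Q (0, 1, 0, 0) \<in> totally_positive_integers K" "qval P Q (4 * n, -1, 0, 0) \<in> totally_positive_integers K"
    "qval P Q (0, 0, 1, 0) \<in> totally_positive_integers K" "qval P Q (4 * n - 1, 0, -1, 0) \<in> totally_positive_integers K"
    unfolding totally_positive_iff unfolding qval_def using PP' QQ' pos ord by auto
  show units: "P \<in> totally_positive_units K" "P' \<in> totally_positive_units K"
    "Q \<in> totally_positive_units K" "Q' \<in> totally_positive_units K"
    unfolding totally_positive_units_def
    using tp[folded val] integer_unitI[of "(0, 1, 0, 0)" "(4 * n, -1, 0, 0)", folded val]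
      integer_unitI[of "(4 * n, -1, 0, 0)" "(0, 1, 0, 0)", folded val]
      integer_unitI[of "(0, 0, 1, 0)" "(4 * n - 1, 0, -1, 0)", folded val]
      integer_unitI[of "(4 * n - 1, 0, -1, 0)" "(0, 0, 1, 0)", folded val] PP' QQ'
    by (auto simp: mult.commute)
  \<comment> \<open>PQ - 1 and Q' - P' are units of mixed signature; only their squares, multiplied
    by totally positive units, are needed.\<close>
  have "(P * Q - 1) * (Q' - P') = P * (Q * Q') - Q * (P * P') - Q' + P'" by (simp add: algebra_simps)
  also have "\<dots> = 1" using PP' QQ' by simp
  finally have U: "(P * Q - 1) * (Q' - P') = 1" .
  have "P * Q - 1 \<in> integer_units K" "Q' - P' \<in> integer_units K"
    using integer_unitI[of "(-1, 0, 0, 1)" "(-1, 1, -1, 0)", folded val]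
      integer_unitI[of "(-1, 1, -1, 0)" "(-1, 0, 0, 1)", folded val] U by (auto simp: mult.commute)
  then show "(P * Q - 1) * (P * Q - 1) * (P' * Q') \<in> totally_positive_units K"
    "(Q' - P') * (Q' - P') * (P * Q) \<in> totally_positive_units K"
    using integer_units_square[OF subfield_K] units mult by blast+
qed

lemma totally_positive_integers_K: "totally_positive_integers K = qval P Q ` {w. qpos w}"
proof -
  have "totally_positive_integers K \<subseteq> range (qval P Q)"
    using ring_of_integers_K unfolding totally_positive_integers_def by blast
  then show ?thesis unfolding qpos_def totally_positive_iff[symmetric] by blast
qed

text \<open>Uniqueness of coordinates lets \<open>L\<close>, which is defined on integer vectors, be
  read as an additive function on the integers of \<open>K\<close>.\<close>

lemma qval_inj: "qval P Q v = qval P Q w \<Longrightarrow> v = w"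
proof -
  obtain a b c d where v: "v = (a, b, c, d)" by (cases v)
  obtain e f g h where w: "w = (e, f, g, h)" by (cases w)
  have qval: "qval P Q (a, b, c, d) =
     ((of_int a + 2 * of_int n * of_int b + (4 * of_int n - 1) * (of_int c + 2 * of_int n * of_int d) / 2)
       + (of_int b + (4 * of_int n - 1) * of_int d / 2) * s)
     + ((of_int c / 2 + of_int n * of_int d) + (of_int d / 2) * s) * t" for a b c d :: int
    unfolding qval_def P_def Q_def by (simp add: field_simps)
  assume "qval P Q v = qval P Q w"
  note eqs = this[unfolded v w qval, THEN coordinates_unique[rotated -1]]
  have "d = h" using eqs by simp
  moreover from this have "b = f" "c = g" using eqs by simp_all
  moreover from calculation have "a = e" using eqs by simp
  ultimately show ?thesis unfolding v w by simp
qed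

section \<open>Indecomposability and completeness of the candidates\<close>

lemma L_one_indecomposable:
  assumes "qpos w" "L w = 1"
  shows "qval P Q w \<in> indecomposables K"
proof -
  have False if bc: "b \<in> totally_positive_integers K" "c \<in> totally_positive_integers K" "qval P Q w = b + c" for b c
  proof -
    obtain v v' where v: "b = qval P Q v" "qpos v" and v': "c = qval P Q v'" "qpos v'"
      using bc(1,2) unfolding totally_positive_integers_K by blast
    obtain x1 x2 x3 x4 where x: "v = (x1, x2, x3, x4)" by (cases v)
    obtain y1 y2 y3 y4 where y: "v' = (y1, y2, y3, y4)" by (cases v')
    have "qval P Q (x1 + y1, x2 + y2, x3 + y3, x4 + y4) = qval P Q v + qval P Q v'"
      unfolding x y qval_def by (simp add: algebra_simps)
    then have "qval P Q w = qval P Q (x1 + y1, x2 + y2, x3 + y3, x4 + y4)" using bc(3) v v' by simp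
    then have "L w = L v + L v'" using qval_inj L_add unfolding x y by metis
    then show False using L_pos[OF v(2)] L_pos[OF v'(2)] assms(2) by simp
  qed
  then show ?thesis
    unfolding indecomposables_def using assms(1) totally_positive_integers_K by blast
qed

definition C :: "int \<Rightarrow> real" where
  "C k = U * (of_int k - P')"

lemma C_indecomposable: "1 \<le> k \<Longrightarrow> k \<le> 4 * n - 2 \<Longrightarrow> C k \<in> indecomposables K"
  using L_one_indecomposable[OF qpos_cone_quad L_cone_quad] unfolding C_def qval_cone_quad' by blast

lemma one_indecomposable: "1 \<in> indecomposables K"
  using L_one_indecomposable[of "(1, 0, 0, 0)"] unfolding qpos_def L_def qval_def by simp

lemma gen_totally_positive: "x \<in> gen \<Longrightarrow> x \<in> totally_positive_integers K"
proof (induction rule: gen.induct)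
  case (cone u k)
  then have "u * C k \<in> indecomposables K"
    by (intro indecomposables_unit_mult[OF subfield_K] C_indecomposable)
  then show ?case unfolding C_def indecomposables_def by blast
next
  case (add x y)
  then show ?case using totally_positive_integers_closed(1)[OF subfield_K] by blast
qed (use totally_positive_units_subset in blast)

text \<open>Every totally positive integer lies in \<open>gen\<close>, and all elements of
  \<open>gen\<close> are totally positive, so for an indecomposable element the last rule used
  cannot be a sum.\<close>

lemma indecomposable_cases:
  assumes a: "a \<in> indecomposables K"
  obtains "a \<in> totally_positive_units K"
  | u k where "u \<in> totally_positive_units K" "1 \<le> k" "k \<le> 4 * n - 2" "a = u * C k"
proof -
  obtain w where "qpos w" "a = qval P Q w"
    using a totally_positive_integers_K unfolding indecomposables_def by blast
  then have "a \<in> gen" using qpos_in_gen by blast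
  then show ?thesis
  proof (cases rule: gen.cases)
    case (add x y)
    then show ?thesis using a gen_totally_positive unfolding indecomposables_def by blast
  qed (use that C_def in auto)
qed

section \<open>Inequivalence of the representatives\<close>

lemma fundamental_unit_F: "fundamental_unit F \<epsilon> \<Longrightarrow> \<epsilon> = P"
  unfolding F_eq P_def s_def
  using fundamental_unit_sqrt[OF sqfree(1) p_eq p_mod, of \<epsilon>] n by simp

text \<open>Positive units of \<open>F\<close> are powers of P, so 1 is the only one strictly
  between P' and P. This gap separates the candidates from one another and from the units.\<close>

lemma unit_of_F:
  assumes P: "fundamental_unit F P" and u: "u \<in> integer_units K" "u \<in> F" "u > 0"
  shows "u = 1 \<or> P \<le> u \<or> u \<le> P'"
proof -
  obtain v where v: "v \<in> ring_of_integers K" "u \<in> ring_of_integers K" "u * v = 1"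
    using u(1) unfolding integer_units_def by blast
  have "u \<noteq> 0" using v(3) by auto
  then have "v = inverse u" using v(3) by (simp add: field_simps)
  then have "v \<in> F" using real_subfieldD(6)[OF subfield_F u(2)] by simp
  then have "u \<in> integer_units F"
    using u(2) v unfolding integer_units_def ring_of_integers_def by blast
  then obtain k :: int where "u = P powi k \<or> u = - (P powi k)" using P unfolding fundamental_unit_def by blast
  moreover have "P powi k > 0" using ord by simp
  ultimately have k: "u = P powi k" using u(3) by linarith
  have P': "P' = P powi (-1)" using PP'(2) ord by (simp add: power_int_minus field_simps)
  consider "k = 0" | "k \<ge> 1" | "k \<le> -1" by linarith
  then show ?thesis
  proof cases
    case 1
    then show ?thesis using k by simp
  next
    case 2
    then have "P powi 1 \<le> P powi k" using ord by (intro power_int_increasing) auto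
    then show ?thesis using k by simp
  next
    case 3
    then have "P powi k \<le> P powi (-1)" using ord by (intro power_int_increasing) auto
    then show ?thesis unfolding k P' by blast
  qed
qed

lemma P'_F: "P' \<in> F"
  unfolding P'_def F_def by (intro adjoin_sqrt_cong[of _ "2 * of_int n" "-1"]) auto

lemma P'_small: "P' < 1 / 7"
proof -
  have "P * P' > 7 * P'" using PQ_order(3) n inverse_bounds(1) by (intro mult_strict_right_mono) auto
  then show ?thesis using PP' by simp
qed

text \<open>As U is a unit, k - P' would be a unit of \<open>F\<close>. It lies strictly between P'
  and P, and it is not 1 because P' is not an integer.\<close>

lemma C_not_unit:
  assumes P: "fundamental_unit F P" and k: "1 \<le> k" "k \<le> 4 * n - 2"
  shows "C k \<notin> totally_positive_units K"
proof
  assume C: "C k \<in> totally_positive_units K"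
  have U': "U' = qval P Q (-1, 1, -1, 0)" unfolding U'_eq(1) qval_def by simp
  have U: "U = qval P Q (-1, 0, 0, 1)" unfolding U_def qval_def by simp
  define x where "x = of_int k - P'"
  have "U' * C k = (U * U') * x" unfolding C_def x_def by (simp only: mult_ac)
  then have x_eq: "x = U' * C k" using UU' by simp
  obtain v where v: "C k \<in> ring_of_integers K" "v \<in> ring_of_integers K" "C k * v = 1"
    using C unfolding totally_positive_units_def integer_units_def by blast
  have "x * (U * v) = (U * U') * (C k * v)" unfolding x_eq by (simp only: mult_ac)
  then have "x * (U * v) = 1" using UU' v(3) by simp
  moreover have "x \<in> ring_of_integers K" "U * v \<in> ring_of_integers K"
    unfolding x_eq U U' using v by (auto intro!: ring_of_integers_closed(2)[OF subfield_K] qval_P_Q_integer)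
  ultimately have "x \<in> integer_units K" unfolding integer_units_def by blast
  moreover have "x \<in> F" unfolding x_def
    by (intro real_subfieldD(7)[OF subfield_F] real_subfield_of_int[OF subfield_F] P'_F)
  moreover have "x > 0" unfolding x_def using k inverse_bounds by simp
  ultimately consider "x = 1" | "P \<le> x" | "x \<le> P'" using unit_of_F[OF P] by blast
  then show False
  proof cases
    case 1
    then have "real_of_int (k - 1) = P'" unfolding x_def by simp
    then have "0 < real_of_int (k - 1)" "real_of_int (k - 1) < 1" using inverse_bounds by auto
    then show False by simp
  next
    case 2
    have "real_of_int k \<le> of_int (4 * n - 2)" using k(2) by (simp only: of_int_le_iff)
    then show False using 2 inverse_bounds PQ_order(3) unfolding x_def by simp
  next
    case 3
    then show False using P'_small k(1) unfolding x_def by simp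
  qed
qed

text \<open>The factor U cancels, so the quotient (l - P') / (k - P') is a unit that lies in
  \<open>F\<close>. It lies in the gap around 1 and must be 1.\<close>

lemma C_inequivalent:
  assumes P: "fundamental_unit F P" and k: "1 \<le> k" "k \<le> 4 * n - 2" and l: "1 \<le> l" "l \<le> 4 * n - 2"
    and u: "u \<in> totally_positive_units K" "C l = u * C k"
  shows "k = l"
proof -
  have U0: "U \<noteq> 0" using UU' by auto
  have pos: "0 < of_int k - P'" "0 < of_int l - P'" using k l inverse_bounds by simp_all
  have eq: "of_int l - P' = u * (of_int k - P')" using u(2) U0 unfolding C_def by simp
  then have "u = (of_int l - P') / (of_int k - P')" using pos by (simp add: field_simps)
  also have "\<dots> \<in> F"
    by (intro real_subfieldD(7,8)[OF subfield_F] real_subfield_of_int[OF subfield_F] P'_F)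
  finally have "u \<in> F" .
  moreover have "u > 0" using eq pos zero_less_mult_pos2 by metis
  moreover have "u \<in> integer_units K" using u(1) unfolding totally_positive_units_def by blast
  ultimately consider "u = 1" | "P \<le> u" | "u \<le> P'" using unit_of_F[OF P] by blast
  then show ?thesis
  proof cases
    case 1
    then show ?thesis using eq by simp
  next
    case 2
    \<comment> \<open>The smallest denominator is 1 - P', and P (1 - P') = P - 1 already exceeds 4n
      - 2, hence l - P'. The last case is the same estimate with k and l exchanged.\<close>
    have "P * (1 - P') \<le> u * (of_int k - P')" using 2 k pos inverse_bounds ord by (intro mult_mono) auto
    moreover have "P * (1 - P') = P - 1" using PP' by (simp add: algebra_simps)
    moreover have "real_of_int l \<le> of_int (4 * n - 2)" using l(2) by (simp only: of_int_le_iff)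
    ultimately show ?thesis using eq inverse_bounds PQ_order(3) by simp
  next
    case 3
    have "P * (of_int l - P') = P * u * (of_int k - P')" unfolding eq by simp
    also have "\<dots> \<le> 1 * (of_int k - P')"
    proof (rule mult_right_mono)
      show "P * u \<le> 1" using 3 ord PP' mult_left_mono[of u P' P] by simp
    qed (use pos in simp)
    finally have 1: "P * (of_int l - P') \<le> of_int k - P'" by simp
    have "P * (1 - P') \<le> P * (of_int l - P')" using l ord by (intro mult_left_mono) auto
    moreover have "P * (1 - P') = P - 1" using PP' by (simp add: algebra_simps)
    moreover have "real_of_int k \<le> of_int (4 * n - 2)" using k(2) by (simp only: of_int_le_iff)
    ultimately show ?thesis using 1 inverse_bounds PQ_order(3) by simp
  qed
qed

text \<open>The upper half of the progression is divided by P, which turns it into the family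
  written with \<epsilon>_r; its parameter is k - 2n.\<close>

definition rep :: "int \<Rightarrow> real" where
  "rep k = (if k \<le> 2 * n - 1 then 1 else P') * C k"

lemma complete_set_rep:
  assumes P: "fundamental_unit F P"
  shows "complete_set_of_indecomposables K (insert 1 (rep ` {1..4 * n - 2}))"
    and "int (iota K) = 4 * n - 1"
proof -
  let ?S = "insert 1 (rep ` {1..4 * n - 2})"
  note mult = totally_positive_units_mult[OF subfield_K]
  define f where "f k = (if k \<le> 2 * n - 1 then 1 else P')" for k
  define g where "g k = (if k \<le> 2 * n - 1 then 1 else P)" for k
  have fg: "f k \<in> totally_positive_units K" "g k \<in> totally_positive_units K" "f k * g k = 1" for k
    unfolding f_def g_def using E1 PQ_E PP' by (auto simp: mult.commute)
  have rep: "rep k = f k * C k" "C k = g k * rep k" for k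
  proof -
    show *: "rep k = f k * C k" unfolding rep_def f_def ..
    have "g k * rep k = (f k * g k) * C k" unfolding * by (simp only: mult_ac)
    then show "C k = g k * rep k" using fg by simp
  qed
  have not_unit: "u * rep k \<noteq> v"
    if uv: "u \<in> totally_positive_units K" "v \<in> totally_positive_units K" and k: "k \<in> {1..4 * n - 2}" for u v k
  proof
    assume eq: "u * rep k = v"
    obtain u' where u': "u' \<in> totally_positive_units K" "u * u' = 1"
      using totally_positive_unit_inverse[OF subfield_K uv(1)] .
    have "g k * (u' * v) = (u * u') * (g k * rep k)" unfolding eq[symmetric] by (simp only: mult_ac)
    then have "g k * (u' * v) = C k" unfolding u'(2) rep(2)[of k] mult_1 .
    moreover have "g k * (u' * v) \<in> totally_positive_units K" using mult fg u' uv by blast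
    ultimately show False using C_not_unit[OF P] k by simp
  qed
  have ineq: "k = l"
    if u: "u \<in> totally_positive_units K" and kl: "k \<in> {1..4 * n - 2}" "l \<in> {1..4 * n - 2}" and eq: "rep l = u * rep k" for u k l
  proof -
    have "C l = g l * (u * (f k * C k))" using rep(2)[of l] eq rep(1)[of k] by simp
    also have "\<dots> = (g l * (u * f k)) * C k" by (simp only: mult_ac)
    finally have "C l = (g l * (u * f k)) * C k" .
    moreover have "g l * (u * f k) \<in> totally_positive_units K" using mult fg u by blast
    ultimately show ?thesis using C_inequivalent[OF P] kl by simp
  qed
  have S: "?S \<subseteq> indecomposables K"
    unfolding rep(1) using one_indecomposable C_indecomposable indecomposables_unit_mult[OF subfield_K] fg by auto
  have cover: "\<exists>s\<in>?S. \<exists>u\<in>totally_positive_units K. a = u * s" if a: "a \<in> indecomposables K" for a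
    using a
  proof (cases rule: indecomposable_cases)
    case 1
    then show ?thesis by auto
  next
    case (2 u k)
    have "a = (u * g k) * rep k" unfolding 2(4) rep(2)[of k] by (simp only: mult_ac)
    moreover have "u * g k \<in> totally_positive_units K" using mult fg 2(1) by blast
    ultimately show ?thesis using 2(2,3) by auto
  qed
  have uniq: "s = s'" if s: "s \<in> ?S" "s' \<in> ?S" "u \<in> totally_positive_units K" "s' = u * s" for s s' u
  proof -
    consider "s = 1" "s' = 1" | k where "s = 1" "k \<in> {1..4 * n - 2}" "s' = rep k"
      | k where "s' = 1" "k \<in> {1..4 * n - 2}" "s = rep k"
      | k l where "k \<in> {1..4 * n - 2}" "s = rep k" "l \<in> {1..4 * n - 2}" "s' = rep l"
      using s(1,2) by blast
    then show ?thesis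
    proof cases
      case (2 k)
      then show ?thesis using not_unit[OF E1 s(3), of k] s(4) by simp
    next
      case (3 k)
      then show ?thesis using not_unit[OF s(3) E1, of k] s(4) by simp
    next
      case (4 k l)
      then show ?thesis using ineq[OF s(3)] s(4) by metis
    qed simp
  qed
  show "complete_set_of_indecomposables K ?S"
    by (rule complete_set_of_indecomposablesI(1)[OF subfield_K S cover uniq])
  have "inj_on rep {1..4 * n - 2}"
    by (rule inj_onI) (use ineq[OF E1] in auto)
  moreover have "1 \<notin> rep ` {1..4 * n - 2}" using not_unit[OF E1 E1] by force
  ultimately have "card ?S = Suc (nat (4 * n - 2))" by (simp add: card_image)
  moreover have "iota K = card ?S"
    by (rule complete_set_of_indecomposablesI(2)[OF subfield_K S cover uniq])
  ultimately show "int (iota K) = 4 * n - 1" using n by simp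
qed

text \<open>From P' U = Q - P' one gets P' C(2n + j) = (Q - P')(2n + j - P'). The constant term is
  (Q - P')(P - P') / 2 because 2 (2n - P') = P - P', and this product equals P' + R by R = P Q + P'
  Q' - 2.\<close>

lemma rep_eq:
  assumes r: "R = of_int (8 * n ^ 2 - 2 * n - 2) + s * t"
  shows "insert 1 (rep ` {1..4 * n - 2}) =
    {1} \<union> {(P' + R) / 2 + of_int j * (Q - P') | j :: int. 0 \<le> j \<and> j \<le> 2 * n - 2}
    \<union> {(P' - Q) + of_int j * (P * Q - 1) | j :: int. 1 \<le> j \<and> j \<le> 2 * n - 1}"
proof -
  have "R = P * Q + P' * Q' - 2"
    unfolding r P_def P'_def Q_def Q'_def by (simp add: field_simps power2_eq_square)
  then have R: "R = P * Q + P' * (4 * of_int n - 1 - Q) - 2" unfolding Q'_eq .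
  have PU: "P' * U = Q - P'"
  proof -
    have "P' * U = (P * P') * Q - P'" unfolding U_def by (simp add: algebra_simps)
    then show ?thesis using PP' by simp
  qed
  have C: "C k = (P' - Q) + of_int k * (P * Q - 1)" for k
  proof -
    have "C k = of_int k * (P * Q - 1) - P' * U" unfolding C_def U_def by (simp add: algebra_simps)
    then show ?thesis unfolding PU by simp
  qed
  have A: "P' * C (2 * n + j) = (P' + R) / 2 + of_int j * (Q - P')" for j
  proof -
    have "P' * C (2 * n + j) = (P' * U) * (of_int (2 * n + j) - P')" unfolding C_def by (simp only: mult_ac)
    also have "\<dots> = of_int j * (Q - P') + (Q - P') * (4 * of_int n - 2 * P') / 2"
      unfolding PU by (simp add: field_simps)
    also have "4 * of_int n - 2 * P' = P - P'" using PP' by simp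
    also have "(Q - P') * (P - P') = P * Q - P' * Q - P * P' + P' * P'" by (simp add: algebra_simps)
    also have "\<dots> = P' + R" unfolding R sq_P' using PP' by (simp add: algebra_simps)
    finally show ?thesis by simp
  qed
  have split: "{1..4 * n - 2} = {1..2 * n - 1} \<union> (\<lambda>j. 2 * n + j) ` {0..2 * n - 2}"
    using n by (auto simp: image_iff intro: bexI[of _ "_ - 2 * n"])
  have 1: "rep ` {1..2 * n - 1} = {(P' - Q) + of_int j * (P * Q - 1) | j :: int. 1 \<le> j \<and> j \<le> 2 * n - 1}"
    unfolding rep_def C by (auto simp: image_iff)
  have 2: "rep (2 * n + j) = (P' + R) / 2 + of_int j * (Q - P')" if "0 \<le> j" for j
    unfolding rep_def using that A by simp
  have 3: "rep ` (\<lambda>j. 2 * n + j) ` {0..2 * n - 2} = {(P' + R) / 2 + of_int j * (Q - P') | j :: int. 0 \<le> j \<and> j \<le> 2 * n - 2}"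
    unfolding image_image using 2 by (auto simp: image_iff)
  show ?thesis unfolding split image_Un 1 3 by blast
qed

lemma fundamental_unit_q:
  assumes "fundamental_unit (rat_adjoin {sqrt (of_int q)}) \<epsilon>"
  shows "\<epsilon> = Q"
proof -
  have "\<epsilon> = (of_int (4 * n - 1) + of_int 1 * sqrt (of_int q)) / 2"
  proof (rule fundamental_unit_quadratic)
    show "1 ^ 2 * q = (4 * n - 1) ^ 2 - 4" unfolding q_eq by simp
    show "fundamental_unit (rat_adjoin {sqrt (of_int q)}) \<epsilon>" by (rule assms)
  qed (use n sqfree q_gt_1 in simp_all)
  then show ?thesis by (simp add: Q_def t_def)
qed

lemma fundamental_unit_r:
  assumes "fundamental_unit (rat_adjoin {sqrt (of_int (p * q))}) \<epsilon>"
  shows "\<epsilon> = of_int (8 * n ^ 2 - 2 * n - 2) + s * t"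
proof -
  have "p * q mod 4 = (p mod 4) * (q mod 4) mod 4" by (simp add: mod_mult_eq)
  then have mod: "p * q mod 4 = 3" by (simp add: p_mod q_mod)
  have "p * q = (8 * n ^ 2 - 2 * n - 2) ^ 2 - 1" unfolding p_eq q_eq by (simp add: power2_eq_square algebra_simps)
  moreover have "2 * 2 \<le> n * n" "2 * n \<le> n * n" using n mult_mono[of 2 n 2 n] mult_right_mono[of 2 n n] by simp_all
  then have "8 * n ^ 2 - 2 * n - 2 \<ge> 3" unfolding power2_eq_square by linarith
  ultimately show ?thesis using fundamental_unit_sqrt[OF sqfree_pq _ mod _ assms] unfolding st by blast
qed

end

theorem theorem5p3:
  fixes n p q r :: int and K :: "real set" and \<epsilon>\<^sub>p \<epsilon>\<^sub>q \<epsilon>\<^sub>r :: real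
  assumes "n \<ge> 9"
    and "p = (2 * n - 1) * (2 * n + 1)"
    and "q = (4 * n - 3) * (4 * n + 1)"
    and "coprime p q" and "squarefree p" and "squarefree q"
    and "K = rat_adjoin {sqrt (of_int p), sqrt (of_int q)}"
    and "r = p * q"
    and "fundamental_unit (rat_adjoin {sqrt (of_int p)}) \<epsilon>\<^sub>p"
    and "fundamental_unit (rat_adjoin {sqrt (of_int q)}) \<epsilon>\<^sub>q"
    and "fundamental_unit (rat_adjoin {sqrt (of_int r)}) \<epsilon>\<^sub>r"
  shows "complete_set_of_indecomposables K
           ({1}
            \<union> {(inverse \<epsilon>\<^sub>p + \<epsilon>\<^sub>r) / 2 + of_int t * (\<epsilon>\<^sub>q - inverse \<epsilon>\<^sub>p) | t :: int. 0 \<le> t \<and> t \<le> 2 * n - 2}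
            \<union> {(inverse \<epsilon>\<^sub>p - \<epsilon>\<^sub>q) + of_int t * (\<epsilon>\<^sub>p * \<epsilon>\<^sub>q - 1) | t :: int. 1 \<le> t \<and> t \<le> 2 * n - 1})
         \<and> int (iota K) = 4 * n - 1"
proof -
  interpret fam: biquadratic_family n p q
    using assms by unfold_locales auto
  have F: "rat_adjoin {sqrt (of_int p)} = fam.F" and K: "K = fam.K"
    using fam.F_eq fam.K_eq assms(7) by auto
  have p: "\<epsilon>\<^sub>p = fam.P" using assms(9) fam.fundamental_unit_F unfolding F by blast
  have q: "\<epsilon>\<^sub>q = fam.Q" using assms(10) fam.fundamental_unit_q by blast
  have P: "fundamental_unit fam.F fam.P" using assms(9) unfolding F p .
  have inv: "inverse fam.P = fam.P'"
    using fam.PP'(2) by (rule inverse_unique)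
  show ?thesis
    using fam.complete_set_rep[OF P] fam.rep_eq[OF fam.fundamental_unit_r] assms(8,11)
    unfolding K p q inv by simp
qed

end
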